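(* Let $d\in\{2,3\}$ and $\mu>0$. Let $\varepsilon\in\mathbb{R}^{d\times d}$ be symmetric positive definite, and if $d=3$ assume $\varepsilon=\operatorname{diag}(\varepsilon_1,\varepsilon_2,\varepsilon_3)$ with $\#\{\varepsilon_1,\varepsilon_2,\varepsilon_3\}\le2$. Let $P(\omega,D)$ be the time-harmonic Maxwell operator in dimension $d$ (see context). Let $\ell>0$ and $1<p,q<\infty$ with $(1/p,1/q)\in\tilde{\mathcal{R}}_0^{1/2}(d)$, and let $C>0$ be a constant such that $$\|P(\omega,D)^{-1}\|_{L_0^p(\mathbb{R}^d)\to L_0^q(\mathbb{R}^d)}\le C\,\kappa_{p,q}(\omega)\qquad\text{for all }\omega\in\mathbb{C}\setminus\mathbb{R}.$$ Let $V:\mathbb{R}^d\to\mathbb{C}^{m(d)\times m(d)}$ be a potential and suppose that there is $t\in(0,1)$ such that $$\|V\|_{L^{\frac{pq}{q-p}}}\le t\,(C\ell)^{-1}.$$ If $E\in\mathbb{C}\setminus\mathbb{R}$ is an eigenvalue of $P+V$ acting in $L^q_0(\mathbb{R}^d)$, then $E\in\mathbb{C}\setminus\mathcal{Z}_{p,q}(\ell)$, where $$\mathcal{Z}_{p,q}(\ell)=\{\omega\in\mathbb{C}\setminus\mathbb{R}:\kappa_{p,q}(\omega)\le\ell\}.$$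
   Context: Maxwell operators. For $d=2$: $(\varepsilon_{ij})$ denotes the entries of $\varepsilon^{-1}$, and $P(\omega,D)$ acts on $\mathbb{C}^3$-valued functions $(D_1,D_2,B)$ on $\mathbb{R}^2$ by $$P(\omega,D)=\begin{pmatrix} i\omega&0&-\mu^{-1}\partial_2\\0&i\omega&\mu^{-1}\partial_1\\ \partial_1\varepsilon_{21}-\partial_2\varepsilon_{11}&\partial_1\varepsilon_{22}-\partial_2\varepsilon_{12}&i\omega\end{pmatrix}.$$ For $d=3$: $P(\omega,D)$ acts on $\mathbb{C}^3\times\mathbb{C}^3$-valued functions $(D,B)$ on $\mathbb{R}^3$ by $$P(\omega,D)=\begin{pmatrix} i\omega&-\mu^{-1}\nabla\times\\ \nabla\times(\varepsilon^{-1}\,\cdot)&i\omega\end{pmatrix}.$$ For $\omega\in\mathbb{C}\setminus\mathbb{R}$, $P(\omega,D)^{-1}$ is the Fourier multiplier whose symbol is the inverse of the matrix symbol of $P(\omega,D)$. Eigenvalues. $E\in\mathbb{C}\setminus\mathbb{R}$ is an eigenvalue of $P+V$ acting in $L^q_0$ if there is $u\in L^q_0(\mathbb{R}^d)$, $u\ne0$, with $P(E,D)u+Vu=0$ in $(\mathcal{S}'(\mathbb{R}^d))^{m(d)}$. Spaces and norms. $m(2)=3$, $m(3)=6$. $L^p_0(\mathbb{R}^2)=\{(f_1,f_2,f_3)\in L^p(\mathbb{R}^2)^3:\partial_1f_1+\partial_2f_2=0\text{ in }\mathcal{S}'\}$; $L^p_0(\mathbb{R}^3)=\{(f_1,\dots,f_6)\in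 L^p(\mathbb{R}^3)^6:\nabla\cdot(f_1,f_2,f_3)=\nabla\cdot(f_4,f_5,f_6)=0\text{ in }\mathcal{S}'\}$, with norm the $L^p$ norm of the pointwise Euclidean length. $\|V\|_{L^r}$ is the $L^r$ norm of the pointwise operator norm of $V$; $\frac{pq}{q-p}=\infty$ if $p=q$. Notation. $\gamma_{p,q}=\max\{0,\,1-\tfrac{d+1}{2}(\tfrac1p-\tfrac1q),\,\tfrac{d+1}{2}-\tfrac dp,\,\tfrac dq-\tfrac{d-1}{2}\}$ and $\kappa_{p,q}(\omega)=|\omega|^{-1+d(\frac1p-\frac1q)+\gamma_{p,q}}\operatorname{dist}(\omega,\mathbb{R})^{-\gamma_{p,q}}$. Regions. $\mathcal{R}_0^{1/2}(d)=\{(x,y)\in[0,1]^2:0\le x-y\le\tfrac1d\}\setminus\{(1,\tfrac{d-1}{d}),(\tfrac1d,0)\}$. $\tilde{\mathcal{R}}_0^{1/2}(2)=\mathcal{R}_0^{1/2}(2)$. $\tilde{\mathcal{R}}_0^{1/2}(3)$ is the set of $(1/p,1/q)\in\mathcal{R}_0^{1/2}(3)$ for which $\|((-\Delta)^{1/2}-\omega)^{-1}\|_{L^p(\mathbb{R}^3)\to L^q(\mathbb{R}^3)}\sim|\omega|^{-1+3(\frac1p-\frac1q)+\gamma_{p,q}}\operatorname{dist}(\omega,[0,\infty))^{-\gamma_{p,q}}$ with constants independent of $\omega\in\mathbb{C}\setminus[0,\infty)$ (here $d=3$ in $\gamma_{p,q}$, and $((-\Delta)^{1/2}-\omega)^{-1}$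 has Fourier symbol $(\|\xi\|-\omega)^{-1}$). *)

theory Defs
  imports "HOL-Analysis.Analysis" "HOL-Probability.Essential_Supremum"
begin

section \<open>Lebesgue spaces\<close>

text \<open>Elements of \<open>Lp p\<close> are functions, not classes modulo null sets; ``nonzero'' therefore has
  to be read almost everywhere below.\<close>

definition Lp_norm :: "ennreal \<Rightarrow> (real^'n \<Rightarrow> 'b::real_normed_vector) \<Rightarrow> ennreal" where
  "Lp_norm p f =
     (if p = \<infinity> then esssup lebesgue (\<lambda>x. ennreal (norm (f x)))
      else let I = (\<integral>\<^sup>+x. ennreal (norm (f x) powr enn2real p) \<partial>lebesgue)
           in if I = \<infinity> then \<infinity> else ennreal (enn2real I powr (1 / enn2real p)))"

definition Lp :: "ennreal \<Rightarrow> (real^'n \<Rightarrow> complex^'m) set" where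
  "Lp p = {f. f \<in> borel_measurable lebesgue \<and> Lp_norm p f < \<infinity>}"


section \<open>Schwartz functions and tempered distributions\<close>

definition pd :: "'n \<Rightarrow> (real^'n \<Rightarrow> complex) \<Rightarrow> real^'n \<Rightarrow> complex" where
  "pd j f x = frechet_derivative f (at x) (axis j 1)"

definition schwartz :: "(real^'n \<Rightarrow> complex) \<Rightarrow> bool" where
  "schwartz f \<longleftrightarrow>
     (\<forall>js. (\<forall>x. foldr pd js f differentiable (at x)) \<and>
           (\<forall>k::nat. \<exists>B. \<forall>x. norm x ^ k * norm (foldr pd js f x) \<le> B))"

definition fourier :: "(real^'n \<Rightarrow> complex) \<Rightarrow> real^'n \<Rightarrow> complex" where
  "fourier f \<xi> = of_real ((2 * pi) powr (- real CARD('n) / 2)) *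
     (LINT x|lebesgue. cis (- (x \<bullet> \<xi>)) * f x)"

text \<open>A tempered distribution with values in \<open>\<complex>\<^sup>m\<close> is represented by its action on scalar test
  functions. Only the values on Schwartz functions matter, so equality of distributions is
  \<open>dist_eq\<close> and not equality in HOL.\<close>

type_synonym ('n, 'm) distribution = "(real^'n \<Rightarrow> complex) \<Rightarrow> complex^'m"

definition dist_eq :: "('n::finite, 'm::finite) distribution \<Rightarrow> ('n::finite, 'm::finite) distribution \<Rightarrow> bool" where
  "dist_eq S T \<longleftrightarrow> (\<forall>\<phi>. schwartz \<phi> \<longrightarrow> S \<phi> = T \<phi>)"

definition regular :: "(real^'n \<Rightarrow> complex^'m) \<Rightarrow> ('n::finite, 'm::finite) distribution" where
  "regular u \<phi> = (LINT x|lebesgue. \<phi> x *s u x)"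

definition dpartial :: "'n \<Rightarrow> ('n::finite, 'm::finite) distribution \<Rightarrow> ('n::finite, 'm::finite) distribution" where
  "dpartial j T \<phi> = - T (pd j \<phi>)"

definition dfourier :: "('n::finite, 'm::finite) distribution \<Rightarrow> ('n::finite, 'm::finite) distribution" where
  "dfourier T \<phi> = T (fourier \<phi>)"

definition dmult :: "(real^'n \<Rightarrow> complex^'m^'m) \<Rightarrow> ('n::finite, 'm::finite) distribution \<Rightarrow> ('n::finite, 'm::finite) distribution"
  where "dmult a T \<phi> = (\<chi> i. \<Sum>j\<in>UNIV. T (\<lambda>\<xi>. a \<xi> $ i $ j * \<phi> \<xi>) $ j)"


section \<open>Fourier multipliers between Lebesgue spaces\<close>

text \<open>\<open>multiplier_graph a f g\<close> says that \<open>g\<close> is the image of \<open>f\<close> under the Fourier multiplier with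
  symbol \<open>a\<close>, that is, the Fourier transform of \<open>g\<close> is \<open>a\<close> times that of \<open>f\<close>. Unfolded, this
  pairs \<open>f\<close> with the functions \<open>fourier (\<lambda>\<xi>. a \<xi> $ i $ j * \<phi> \<xi>)\<close>. These are Schwartz functions
  for the smooth symbols of Maxwell's equations. For the symbol \<open>1 / (norm \<xi> - \<omega>)\<close>, which is not
  smooth at the origin, they are continuous and \<open>O(\<bar>x\<bar> powr (- d - 1))\<close>, so that the pairing is
  still defined on every Lebesgue space.\<close>

definition multiplier_graph ::
    "(real^'n \<Rightarrow> complex^'m^'m) \<Rightarrow> (real^'n \<Rightarrow> complex^'m) \<Rightarrow> (real^'n \<Rightarrow> complex^'m) \<Rightarrow> bool" where
  "multiplier_graph a f g \<longleftrightarrow> dist_eq (dfourier (regular g)) (dmult a (dfourier (regular f)))"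

text \<open>The norm of the multiplier as an operator from \<open>X\<close> with the \<open>L\<^sup>p\<close> norm to \<open>Y\<close> with the
  \<open>L\<^sup>q\<close> norm; it is \<open>\<infinity>\<close> if the multiplier does not map \<open>X\<close> boundedly into \<open>Y\<close>. The
  image \<open>g\<close> of \<open>f\<close> is unique only up to null sets, whence the quantifier over \<open>g\<close>.\<close>

definition multiplier_norm ::
    "ennreal \<Rightarrow> (real^'n \<Rightarrow> complex^'m) set \<Rightarrow> ennreal \<Rightarrow> (real^'n \<Rightarrow> complex^'m) set \<Rightarrow>
     (real^'n \<Rightarrow> complex^'m^'m) \<Rightarrow> ennreal" where
  "multiplier_norm p X q Y a =
     Inf {ennreal K | K. 0 \<le> K \<and>
       (\<forall>f\<in>X. (\<exists>g\<in>Y. multiplier_graph a f g) \<and>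
              (\<forall>g\<in>Y. multiplier_graph a f g \<longrightarrow> Lp_norm q g \<le> ennreal K * Lp_norm p f))}"


section \<open>Divergence-free fields\<close>

definition Lp0_2 :: "ennreal \<Rightarrow> (real^2 \<Rightarrow> complex^3) set" where
  "Lp0_2 p = {f \<in> Lp p. \<forall>\<phi>. schwartz \<phi> \<longrightarrow>
     dpartial 1 (regular f) \<phi> $ 1 + dpartial 2 (regular f) \<phi> $ 2 = 0}"

text \<open>The six components are indexed by \<open>3 + 3\<close>: \<open>Inl i\<close> is the \<open>i\<close>-th component of the first
  field \<open>D\<close>, and \<open>Inr i\<close> that of the second field \<open>B\<close>.\<close>

definition Lp0_3 :: "ennreal \<Rightarrow> (real^3 \<Rightarrow> complex^(3 + 3)) set" where
  "Lp0_3 p = {f \<in> Lp p. \<forall>\<phi>. schwartz \<phi> \<longrightarrow>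
     (\<Sum>i\<in>UNIV. dpartial i (regular f) \<phi> $ Inl i) = 0 \<and>
     (\<Sum>i\<in>UNIV. dpartial i (regular f) \<phi> $ Inr i) = 0}"


section \<open>Time-harmonic Maxwell operators\<close>

text \<open>The symbols are obtained by replacing \<open>\<partial>\<^sub>j\<close> by \<open>\<i> * \<xi> $ j\<close>, in accordance with
  \<open>fourier\<close>.\<close>

definition complex_mat :: "real^'n^'m \<Rightarrow> complex^'n^'m" where
  "complex_mat A = (\<chi> i j. of_real (A $ i $ j))"

definition maxwell2 ::
    "real \<Rightarrow> real^2^2 \<Rightarrow> complex \<Rightarrow> (2, 3) distribution \<Rightarrow> (2, 3) distribution" where
  "maxwell2 \<mu> \<epsilon> \<omega> u \<phi> =
     (let e = complex_mat (matrix_inv \<epsilon>); m = of_real (inverse \<mu>);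
          dd = (\<lambda>j k. dpartial j u \<phi> $ k)
      in vector
        [\<i> * \<omega> * u \<phi> $ 1 - m * dd 2 3,
         \<i> * \<omega> * u \<phi> $ 2 + m * dd 1 3,
         (e $ 2 $ 1 * dd 1 1 - e $ 1 $ 1 * dd 2 1) + (e $ 2 $ 2 * dd 1 2 - e $ 1 $ 2 * dd 2 2)
           + \<i> * \<omega> * u \<phi> $ 3])"

definition maxwell2_symbol ::
    "real \<Rightarrow> real^2^2 \<Rightarrow> complex \<Rightarrow> real^2 \<Rightarrow> complex^3^3" where
  "maxwell2_symbol \<mu> \<epsilon> \<omega> \<xi> =
     (let e = complex_mat (matrix_inv \<epsilon>); m = of_real (inverse \<mu>);
          dd = (\<lambda>j. \<i> * of_real (\<xi> $ j))
      in vector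
        [vector [\<i> * \<omega>, 0, - m * dd 2],
         vector [0, \<i> * \<omega>, m * dd 1],
         vector [dd 1 * e $ 2 $ 1 - dd 2 * e $ 1 $ 1,
                 dd 1 * e $ 2 $ 2 - dd 2 * e $ 1 $ 2, \<i> * \<omega>]])"

definition dcurl :: "(3, 3) distribution \<Rightarrow> (3, 3) distribution" where
  "dcurl T \<phi> = (let dd = (\<lambda>j k. dpartial j T \<phi> $ k)
     in vector [dd 2 3 - dd 3 2, dd 3 1 - dd 1 3, dd 1 2 - dd 2 1])"

definition curl_symbol :: "real^3 \<Rightarrow> complex^3^3" where
  "curl_symbol \<xi> = (let dd = (\<lambda>j. \<i> * of_real (\<xi> $ j))
     in vector [vector [0, - dd 3, dd 2], vector [dd 3, 0, - dd 1], vector [- dd 2, dd 1, 0]])"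

definition maxwell3 ::
    "real \<Rightarrow> real^3^3 \<Rightarrow> complex \<Rightarrow> (3, 3 + 3) distribution \<Rightarrow> (3, 3 + 3) distribution" where
  "maxwell3 \<mu> \<epsilon> \<omega> u \<phi> =
     (let D = (\<lambda>\<psi>. \<chi> i. u \<psi> $ Inl i); B = (\<lambda>\<psi>. \<chi> i. u \<psi> $ Inr i)
      in \<chi> k. case k of
          Inl i \<Rightarrow> \<i> * \<omega> * D \<phi> $ i - of_real (inverse \<mu>) * dcurl B \<phi> $ i
        | Inr i \<Rightarrow> dcurl (\<lambda>\<psi>. complex_mat (matrix_inv \<epsilon>) *v D \<psi>) \<phi> $ i + \<i> * \<omega> * B \<phi> $ i)"

definition maxwell3_symbol ::
    "real \<Rightarrow> real^3^3 \<Rightarrow> complex \<Rightarrow> real^3 \<Rightarrow> complex^(3 + 3)^(3 + 3)" where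
  "maxwell3_symbol \<mu> \<epsilon> \<omega> \<xi> =
     (\<chi> k l. case (k, l) of
          (Inl i, Inl j) \<Rightarrow> if i = j then \<i> * \<omega> else 0
        | (Inl i, Inr j) \<Rightarrow> - of_real (inverse \<mu>) * curl_symbol \<xi> $ i $ j
        | (Inr i, Inl j) \<Rightarrow> (curl_symbol \<xi> ** complex_mat (matrix_inv \<epsilon>)) $ i $ j
        | (Inr i, Inr j) \<Rightarrow> if i = j then \<i> * \<omega> else 0)"

text \<open>\<open>P\<close> is the operator pencil \<open>\<omega> \<mapsto> P(\<omega>, D)\<close> and \<open>X\<close> the function space.\<close>

definition is_eigenvalue ::
    "(complex \<Rightarrow> ('n::finite, 'm::finite) distribution \<Rightarrow> ('n::finite, 'm::finite) distribution) \<Rightarrow>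
     (real^'n \<Rightarrow> complex^'m) set \<Rightarrow> (real^'n \<Rightarrow> complex^'m^'m) \<Rightarrow> complex \<Rightarrow> bool" where
  "is_eigenvalue P X V E \<longleftrightarrow> E \<notin> \<real> \<and>
     (\<exists>u\<in>X. \<not> (AE x in lebesgue. u x = 0) \<and>
        dist_eq (\<lambda>\<phi>. P E (regular u) \<phi> + regular (\<lambda>x. V x *v u x) \<phi>) (\<lambda>_. 0))"


section \<open>Exponents and regions\<close>

text \<open>These are parametrised by \<open>x = 1/p\<close> and \<open>y = 1/q\<close>, so that infinite exponents are
  included as \<open>x = 0\<close> or \<open>y = 0\<close>; note \<open>inverse (0::ennreal) = \<infinity>\<close>.\<close>

definition gam :: "nat \<Rightarrow> real \<Rightarrow> real \<Rightarrow> real" where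
  "gam d x y = Max {0, 1 - (real d + 1) / 2 * (x - y), (real d + 1) / 2 - real d * x,
                    real d * y - (real d - 1) / 2}"

definition kappa :: "nat \<Rightarrow> real \<Rightarrow> real \<Rightarrow> complex \<Rightarrow> real" where
  "kappa d x y \<omega> =
     cmod \<omega> powr (- 1 + real d * (x - y) + gam d x y) * infdist \<omega> \<real> powr (- gam d x y)"

definition Zset :: "nat \<Rightarrow> real \<Rightarrow> real \<Rightarrow> real \<Rightarrow> complex set" where
  "Zset d x y l = {\<omega>. \<omega> \<notin> \<real> \<and> kappa d x y \<omega> \<le> l}"

definition R_half :: "nat \<Rightarrow> (real \<times> real) set" where
  "R_half d = {(x, y). x \<in> {0..1} \<and> y \<in> {0..1} \<and> 0 \<le> x - y \<and> x - y \<le> 1 / real d}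
              - {(1, (real d - 1) / real d), (1 / real d, 0)}"

text \<open>The symbol of the resolvent of the half-Laplacian, as a \<open>1 \<times> 1\<close> matrix.\<close>

definition half_laplacian_resolvent_symbol :: "complex \<Rightarrow> real^'n \<Rightarrow> complex^1^1" where
  "half_laplacian_resolvent_symbol \<omega> \<xi> = mat (inverse (of_real (norm \<xi>) - \<omega>))"

definition half_laplacian_resolvent_norm :: "real \<Rightarrow> real \<Rightarrow> complex \<Rightarrow> ennreal" where
  "half_laplacian_resolvent_norm x y \<omega> =
     (let p = inverse (ennreal x); q = inverse (ennreal y)
      in multiplier_norm p (Lp p) q (Lp q)
           (half_laplacian_resolvent_symbol \<omega> :: real^3 \<Rightarrow> complex^1^1))"

definition R_half_tilde3 :: "(real \<times> real) set" where
  "R_half_tilde3 = {(x, y) \<in> R_half 3.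
     \<exists>c>0. \<exists>c'>0. \<forall>\<omega>. \<omega> \<notin> of_real ` {0..} \<longrightarrow>
       (let A = cmod \<omega> powr (- 1 + 3 * (x - y) + gam 3 x y) *
                infdist \<omega> (of_real ` {0..}) powr (- gam 3 x y)
        in ennreal (c * A) \<le> half_laplacian_resolvent_norm x y \<omega> \<and>
           half_laplacian_resolvent_norm x y \<omega> \<le> ennreal (c' * A))}"


section \<open>Potentials\<close>

definition potential_norm :: "ennreal \<Rightarrow> (real^'n \<Rightarrow> complex^'m^'m) \<Rightarrow> ennreal" where
  "potential_norm r V = Lp_norm r (\<lambda>x. onorm ((*v) (V x)))"

definition potential_exponent :: "real \<Rightarrow> real \<Rightarrow> ennreal" where
  "potential_exponent p q = (if p = q then \<infinity> else ennreal (p * q / (q - p)))"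

definition pos_def :: "real^'n^'n \<Rightarrow> bool" where
  "pos_def A \<longleftrightarrow> transpose A = A \<and> (\<forall>x. x \<noteq> 0 \<longrightarrow> 0 < x \<bullet> (A *v x))"

end

theory Submission
  imports Defs "HOL-Probability.Sinc_Integral" "HOL-Probability.Characteristic_Functions"
begin

text \<open>
  If \<open>P(E, D) u + V u = 0\<close> with \<open>u \<in> L\<^sup>q\<^sub>0\<close>, then \<open>f = - V u\<close> is in \<open>L\<^sup>p\<close> by Hoelder's
  inequality, it is divergence free because \<open>P(E, D)\<close> preserves divergence-free fields, and
  \<open>u\<close> is the image of \<open>f\<close> under the Fourier multiplier \<open>P(E, D)\<^sup>-\<^sup>1\<close>. Hence
  \<open>\<parallel>u\<parallel>\<^sub>q \<le> K t / (C l) \<parallel>u\<parallel>\<^sub>q\<close> for some \<open>K < C l / t\<close> as soon as \<open>\<kappa>(E) \<le> l\<close>, which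
  forces \<open>u = 0\<close>.

  To recover \<open>u\<close> from \<open>f\<close>, the resolvent symbol must act on Schwartz functions. The
  symbol is affine in \<open>\<xi>\<close> and symmetrized by the constant matrix
  \<open>diag (\<epsilon>\<^sup>-\<^sup>1, \<mu>\<^sup>-\<^sup>1)\<close>, so its inverse \<open>R\<close> is bounded uniformly in \<open>\<xi>\<close>; as
  \<open>\<partial>\<^sub>l R = - R A\<^sub>l R\<close> with constant matrices \<open>A\<^sub>l\<close>, all derivatives of \<open>R\<close> are polynomials in
  its entries and are bounded too.
\<close>


section \<open>Partial derivatives and Schwartz functions\<close>

text \<open>The norm of a multiplier is defined as an infimum that need not be attained: a bound by
  \<open>B\<close> only guarantees an admissible constant below each number greater than
  \<open>B\<close>. The factor \<open>t < 1\<close> in the assumption on the potential is the room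
  that absorbs this loss, whence \<open>B / t\<close>. The definition also bounds every partner
  \<open>g\<close> of \<open>f\<close> in the graph, so it is enough that \<open>u\<close> is one of
  them, and no uniqueness theorem for multipliers enters.

  The first-order part of the symbol is degenerate: it annihilates each vector \<open>(D, 0)\<close>
  with \<open>\<epsilon>^-1 D\<close> parallel to \<open>\<xi>\<close>. There the symbol acts as
  \<open>\<i> * \<omega>\<close>, so its inverse does not decay in \<open>\<xi>\<close> and no
  ellipticity is available. Boundedness comes from \<open>Im \<omega>\<close> alone. The resulting
  constant depends on the fixed frequency and never reaches the final estimate, whose quantitative
  input is the assumed norm bound.

  Both dimensions share one abstract argument; they differ in the constant matrices and in the
  computation showing that the operator respects divergence-free fields.\<close>

lemma pd_eqI:
  assumes "(f has_derivative f') (at x)"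
  shows "pd j f x = f' (axis j 1)"
  unfolding pd_def using frechet_derivative_at[OF assms] by simp

lemma pd_const: "pd j (\<lambda>x. c) = (\<lambda>x. 0)"
  by (rule ext, rule pd_eqI[where f'="\<lambda>_. 0"]) simp

lemma pd_add:
  assumes "\<And>x. f differentiable (at x)" "\<And>x. g differentiable (at x)"
  shows "pd j (\<lambda>x. f x + g x) = (\<lambda>x. pd j f x + pd j g x)"
proof
  fix x
  show "pd j (\<lambda>x. f x + g x) x = pd j f x + pd j g x"
    unfolding pd_def[of j f] pd_def[of j g]
    by (rule pd_eqI[where f'="\<lambda>h. frechet_derivative f (at x) h + frechet_derivative g (at x) h"])
      (intro has_derivative_add assms[unfolded frechet_derivative_works])
qed

lemma pd_mult:
  assumes "\<And>x. f differentiable (at x)" "\<And>x. g differentiable (at x)"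
  shows "pd j (\<lambda>x. f x * g x) = (\<lambda>x. f x * pd j g x + pd j f x * g x)"
proof
  fix x
  show "pd j (\<lambda>x. f x * g x) x = f x * pd j g x + pd j f x * g x"
    unfolding pd_def[of j f] pd_def[of j g]
    by (rule pd_eqI[where f'="\<lambda>h. f x * frechet_derivative g (at x) h + frechet_derivative f (at x) h * g x"])
      (intro has_derivative_mult assms[unfolded frechet_derivative_works])
qed

lemma has_derivative_coordinate:
  "((\<lambda>x::real^'n. complex_of_real (x $ l)) has_derivative (\<lambda>h. complex_of_real (h $ l))) (at x)"
  by (intro has_derivative_of_real bounded_linear_imp_has_derivative bounded_linear_vec_nth)

lemma differentiable_coordinate: "(\<lambda>x::real^'n. complex_of_real (x $ l)) differentiable (at x)"
  using has_derivative_coordinate differentiable_def by blast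

lemma pd_coordinate:
  "pd j (\<lambda>x::real^'n. complex_of_real (x $ l)) = (\<lambda>x. if j = l then 1 else 0)"
  by (rule ext, subst pd_eqI[OF has_derivative_coordinate]) (auto simp: axis_def)

text \<open>These are the multipliers of Schwartz space, usually called \<open>O_M\<close>. The
  growth exponent may depend on the derivative. Constants and coordinates belong to it, and so will
  the entries of the resolvent symbol.\<close>

definition moderate :: "(real^'n \<Rightarrow> complex) \<Rightarrow> bool" where
  "moderate a \<longleftrightarrow>
     (\<forall>js. (\<forall>x. foldr pd js a differentiable (at x)) \<and>
           (\<exists>B k. \<forall>x. norm (foldr pd js a x) \<le> B * (1 + norm x) ^ k))"

lemma schwartz_differentiable: "schwartz f \<Longrightarrow> f differentiable (at x)"
  unfolding schwartz_def by (metis foldr_Nil id_apply)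

lemma schwartz_decay: "schwartz f \<Longrightarrow> \<exists>B. \<forall>x. norm x ^ k * norm (f x) \<le> B"
  unfolding schwartz_def by (metis foldr_Nil id_apply)

lemma schwartz_pd: assumes "schwartz f" shows "schwartz (pd j f)"
  unfolding schwartz_def
proof
  fix js
  \<comment> \<open>\<open>foldr\<close> applies the last index first, so an additional inner
    derivative is an index appended at the end.\<close>
  have "foldr pd js (pd j f) = foldr pd (js @ [j]) f" by simp
  then show "(\<forall>x. foldr pd js (pd j f) differentiable (at x)) \<and>
     (\<forall>k. \<exists>B. \<forall>x. norm x ^ k * norm (foldr pd js (pd j f) x) \<le> B)"
    using assms unfolding schwartz_def by metis
qed

lemma moderate_differentiable: "moderate a \<Longrightarrow> a differentiable (at x)"
  unfolding moderate_def by (metis foldr_Nil id_apply)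

lemma moderate_growth: "moderate a \<Longrightarrow> \<exists>B k. \<forall>x. norm (a x) \<le> B * (1 + norm x) ^ k"
  unfolding moderate_def by (metis foldr_Nil id_apply)

lemma moderate_pd: assumes "moderate f" shows "moderate (pd j f)"
  unfolding moderate_def
proof
  fix js
  have "foldr pd js (pd j f) = foldr pd (js @ [j]) f" by simp
  then show "(\<forall>x. foldr pd js (pd j f) differentiable (at x)) \<and>
     (\<exists>B k. \<forall>x. norm (foldr pd js (pd j f) x) \<le> B * (1 + norm x) ^ k)"
    using assms unfolding moderate_def by metis
qed

lemma foldr_pd_closed:
  assumes "f \<in> F" "\<And>g j. g \<in> F \<Longrightarrow> pd j g \<in> F"
  shows "foldr pd js f \<in> F"
  by (induction js) (use assms in auto)

text \<open>Replaces the quantification over all iterated derivatives by a one-step check: in a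
  class closed under \<open>pd\<close>, the conditions of order zero on all members already contain
  those of every order.\<close>

lemma schwartz_coinduct:
  assumes "f \<in> F"
    and "\<And>g x. g \<in> F \<Longrightarrow> g differentiable (at x)"
    and "\<And>g j. g \<in> F \<Longrightarrow> pd j g \<in> F"
    and "\<And>g k. g \<in> F \<Longrightarrow> \<exists>B. \<forall>x. norm x ^ k * norm (g x) \<le> B"
  shows "schwartz f"
  unfolding schwartz_def using foldr_pd_closed[of f F, OF assms(1,3)] assms(2,4) by blast

lemma moderate_coinduct:
  assumes "f \<in> F"
    and "\<And>g x. g \<in> F \<Longrightarrow> g differentiable (at x)"
    and "\<And>g j. g \<in> F \<Longrightarrow> pd j g \<in> F"
    and "\<And>g. g \<in> F \<Longrightarrow> \<exists>B k. \<forall>x. norm (g x) \<le> B * (1 + norm x) ^ k"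
  shows "moderate f"
  unfolding moderate_def using foldr_pd_closed[of f F, OF assms(1,3)] assms(2,4) by blast

lemma moderate_const: "moderate (\<lambda>x. c)"
proof (rule moderate_coinduct[where F="range (\<lambda>c x. c)"])
  fix g :: "real^'n \<Rightarrow> complex" assume "g \<in> range (\<lambda>c x. c)"
  then obtain c where g: "g = (\<lambda>x. c)" by auto
  show "g differentiable (at x)" for x by (simp add: g)
  show "pd j g \<in> range (\<lambda>c x. c)" for j by (simp add: g pd_const)
  show "\<exists>B k. \<forall>x. norm (g x) \<le> B * (1 + norm x) ^ k"
    by (rule exI[of _ "norm c"], rule exI[of _ 0]) (simp add: g)
qed auto

lemma moderate_coordinate: "moderate (\<lambda>x::real^'n. complex_of_real (x $ l))"
\<comment> \<open>Differentiating a coordinate gives a constant, which is already known to be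
  moderate; adding this one function to the moderate ones therefore keeps the class closed.\<close>
proof (rule moderate_coinduct[where F="insert (\<lambda>x. complex_of_real (x $ l)) (Collect moderate)"])
  fix g :: "real^'n \<Rightarrow> complex"
  assume "g \<in> insert (\<lambda>x. complex_of_real (x $ l)) (Collect moderate)"
  then consider "moderate g" | "g = (\<lambda>x. complex_of_real (x $ l))" by auto
  note g = this
  show "g differentiable (at x)" for x
    using g by cases (auto intro: moderate_differentiable differentiable_coordinate)
  show "pd j g \<in> insert (\<lambda>x. complex_of_real (x $ l)) (Collect moderate)" for j
    using g by cases (auto simp: pd_coordinate moderate_const intro: moderate_pd)
  show "\<exists>B k. \<forall>x. norm (g x) \<le> B * (1 + norm x) ^ k"
    using g
  proof cases
    case 2
    show ?thesis
      by (rule exI[of _ 1], rule exI[of _ 1])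
        (auto simp: 2 intro: order_trans[OF component_le_norm_cart])
  qed (rule moderate_growth)
qed auto

lemma rapid_decay_shifted:
  fixes g :: "real^'n \<Rightarrow> complex"
  assumes "\<And>k. \<exists>B. \<forall>x. norm x ^ k * norm (g x) \<le> B"
  shows "\<exists>B. \<forall>x. (1 + norm x) ^ k * norm (g x) \<le> B"
proof -
  obtain B where B: "\<And>x. norm x ^ k * norm (g x) \<le> B" using assms by blast
  obtain C where C: "\<And>x. norm x ^ 0 * norm (g x) \<le> C" using assms by blast
  have "(1 + norm x) ^ k * norm (g x) \<le> 2 ^ k * (C + B)" for x
  proof -
    \<comment> \<open>The sum \<open>1 + norm x\<close> is at most twice its larger summand; the two
      cases decide which one that is.\<close>
    have "(1 + norm x) ^ k \<le> 2 ^ k * (1 + norm x ^ k)"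
    proof (cases "norm x \<le> 1")
      case True
      then have "(1 + norm x) ^ k \<le> 2 ^ k" by (intro power_mono) auto
      also have "\<dots> \<le> 2 ^ k * (1 + norm x ^ k)" by simp
      finally show ?thesis .
    next
      case False
      then have "(1 + norm x) ^ k \<le> (2 * norm x) ^ k" by (intro power_mono) auto
      also have "\<dots> \<le> 2 ^ k * (1 + norm x ^ k)" by (simp add: power_mult_distrib)
      finally show ?thesis .
    qed
    then have "(1 + norm x) ^ k * norm (g x) \<le> 2 ^ k * (1 + norm x ^ k) * norm (g x)"
      by (intro mult_right_mono) auto
    also have "\<dots> = 2 ^ k * (norm x ^ 0 * norm (g x) + norm x ^ k * norm (g x))"
      by (simp add: algebra_simps)
    also have "\<dots> \<le> 2 ^ k * (C + B)" using B[of x] C[of x] by (intro mult_left_mono add_mono) auto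
    finally show ?thesis .
  qed
  then show ?thesis by blast
qed

lemma schwartz_decay': "schwartz f \<Longrightarrow> \<exists>B. \<forall>x. (1 + norm x) ^ k * norm (f x) \<le> B"
  by (rule rapid_decay_shifted[OF schwartz_decay])

text \<open>Products \<open>a * f\<close> are not closed under \<open>pd\<close>, because the
  Leibniz rule produces sums of two of them. Finite sums of products are closed, and this is the
  class used in the coinduction.\<close>

inductive moderate_span :: "(real^'n \<Rightarrow> complex) \<Rightarrow> bool" where
  mult: "moderate a \<Longrightarrow> schwartz f \<Longrightarrow> moderate_span (\<lambda>x. a x * f x)"
| add: "moderate_span f \<Longrightarrow> moderate_span g \<Longrightarrow> moderate_span (\<lambda>x. f x + g x)"

lemma moderate_span_differentiable: "moderate_span f \<Longrightarrow> f differentiable (at x)"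
  by (induction rule: moderate_span.induct)
    (auto intro: differentiable_mult[OF moderate_differentiable schwartz_differentiable])

lemma moderate_span_pd: "moderate_span f \<Longrightarrow> moderate_span (pd j f)"
proof (induction rule: moderate_span.induct)
  case (mult a f)
  show ?case
    using mult
    by (subst pd_mult)
      (simp_all add: moderate_span.add[OF moderate_span.mult moderate_span.mult] moderate_pd schwartz_pd
        moderate_differentiable schwartz_differentiable)
next
  case (add f g)
  then show ?case
    by (subst pd_add) (auto intro: moderate_span.intros moderate_span_differentiable)
qed

lemma moderate_span_decay: "moderate_span f \<Longrightarrow> \<exists>B. \<forall>x. norm x ^ k * norm (f x) \<le> B"
proof (induction rule: moderate_span.induct)
  case (mult a f)
  obtain B m where B: "\<And>x. norm (a x) \<le> B * (1 + norm x) ^ m" using moderate_growth[OF mult(1)] by blast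
  obtain C where C: "\<And>x. (1 + norm x) ^ (k + m) * norm (f x) \<le> C" using schwartz_decay'[OF mult(2)] by blast
  have "norm x ^ k * norm (a x * f x) \<le> \<bar>B\<bar> * C" for x
  proof -
    have "norm x ^ k \<le> (1 + norm x) ^ k" by (intro power_mono) auto
    moreover have "norm (a x) \<le> \<bar>B\<bar> * (1 + norm x) ^ m"
      using B[of x] by (rule order_trans) (intro mult_right_mono, auto)
    ultimately have "norm x ^ k * norm (a x) * norm (f x) \<le>
        (1 + norm x) ^ k * (\<bar>B\<bar> * (1 + norm x) ^ m) * norm (f x)"
      by (intro mult_mono mult_nonneg_nonneg) auto
    also have "\<dots> = \<bar>B\<bar> * ((1 + norm x) ^ (k + m) * norm (f x))" by (simp add: power_add)
    also have "\<dots> \<le> \<bar>B\<bar> * C" using C by (intro mult_left_mono) auto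
    finally show ?thesis by (simp add: norm_mult mult.assoc)
  qed
  then show ?case by blast
next
  case (add f g)
  then obtain B C where "\<And>x. norm x ^ k * norm (f x) \<le> B" "\<And>x. norm x ^ k * norm (g x) \<le> C" by blast
  then have "norm x ^ k * norm (f x + g x) \<le> B + C" for x
    using mult_left_mono[OF norm_triangle_ineq[of "f x" "g x"], of "norm x ^ k"]
    by (smt (verit) distrib_left norm_ge_zero zero_le_power)
  then show ?case by blast
qed

lemma moderate_span_schwartz: "moderate_span f \<Longrightarrow> schwartz f"
  by (rule schwartz_coinduct[where F="Collect moderate_span"])
    (auto intro: moderate_span_differentiable moderate_span_pd moderate_span_decay)

lemma schwartz_mult: "moderate a \<Longrightarrow> schwartz f \<Longrightarrow> schwartz (\<lambda>x. a x * f x)"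
  by (rule moderate_span_schwartz[OF moderate_span.mult])

text \<open>The span is closed under addition by construction, so the constant multiplier 1 gives
  sums without a separate estimate.\<close>

lemma schwartz_add: "schwartz f \<Longrightarrow> schwartz g \<Longrightarrow> schwartz (\<lambda>x. f x + g x)"
  using moderate_span_schwartz[OF moderate_span.add[OF
        moderate_span.mult[OF moderate_const[of 1]] moderate_span.mult[OF moderate_const[of 1]]], of f g]
  by simp

lemma schwartz_cmult: "schwartz f \<Longrightarrow> schwartz (\<lambda>x. c * f x)"
  by (intro schwartz_mult moderate_const)

lemma schwartz_coordinate_mult: "schwartz f \<Longrightarrow> schwartz (\<lambda>x. complex_of_real (x $ j) * f x)"
  by (intro schwartz_mult moderate_coordinate)

lemma schwartz_zero: "schwartz (\<lambda>x. 0)"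
  by (rule schwartz_coinduct[where F="{\<lambda>x. 0}"]) (auto simp: pd_const)

lemma schwartz_sum:
  assumes "finite I" "\<And>i. i \<in> I \<Longrightarrow> schwartz (g i)"
  shows "schwartz (\<lambda>x. \<Sum>i\<in>I. g i x)"
  using assms by (induction I rule: finite_induct) (auto intro: schwartz_add schwartz_zero)

section \<open>Integrals of Schwartz functions and their Fourier transforms\<close>

text \<open>An integrable majorant in product form: by Tonelli its integral is a product of
  one-dimensional integrals of \<open>1 / (1 + x^2)\<close>. It dominates every function with enough
  polynomial decay.\<close>

definition weight :: "real^'n \<Rightarrow> real" where
  "weight x = (\<Prod>b\<in>Basis. inverse (1 + (x \<bullet> b)\<^sup>2))"

lemma weight_nonneg: "0 \<le> weight x"
  unfolding weight_def by (intro prod_nonneg) auto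

lemma integrable_weight: "integrable lebesgue (weight :: real^'n \<Rightarrow> real)"
proof -
  have meas: "(weight :: real^'n \<Rightarrow> real) \<in> borel_measurable borel"
    unfolding weight_def by measurable
  have fin: "(\<integral>\<^sup>+x. ennreal (inverse (1 + x\<^sup>2)) \<partial>(lborel :: real measure)) < \<infinity>"
    using integrable_inverse_1_plus_square
    by (simp add: set_integrable_def integrable_iff_bounded)
  have "(\<integral>\<^sup>+x. ennreal (weight x) \<partial>(lborel :: (real^'n) measure)) =
        (\<integral>\<^sup>+x. (\<Prod>b\<in>Basis. ennreal (inverse (1 + (x \<bullet> b)\<^sup>2))) \<partial>(lborel :: (real^'n) measure))"
    unfolding weight_def by (subst prod_ennreal) auto
  also have "\<dots> = (\<Prod>b\<in>(Basis :: (real^'n) set). (\<integral>\<^sup>+x. ennreal (inverse (1 + x\<^sup>2)) \<partial>lborel))"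
    by (rule nn_integral_lborel_prod) auto
  also have "\<dots> < \<infinity>"
    using fin by (simp add: ennreal_prod_eq_top less_top power_less_top_ennreal)
  finally have "integrable lborel (weight :: real^'n \<Rightarrow> real)"
    using meas by (simp add: integrable_iff_bounded weight_nonneg)
  then show ?thesis
    using meas by (simp add: integrable_completion)
qed

text \<open>Each of the \<open>DIM(real^'n)\<close> factors \<open>1 + (x \<bullet> b)^2\<close> is
  at most \<open>(1 + norm x)^2\<close>, which accounts for the exponent.\<close>

lemma weight_lower: "1 \<le> (1 + norm x) ^ (2 * DIM(real^'n)) * weight (x :: real^'n)"
proof -
  have "(\<Prod>b\<in>(Basis :: (real^'n) set). 1 + (x \<bullet> b)\<^sup>2) \<le> (\<Prod>b\<in>(Basis :: (real^'n) set). (1 + norm x)\<^sup>2)"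
  proof (intro prod_mono conjI)
    fix b :: "real^'n" assume "b \<in> Basis"
    then have "(x \<bullet> b)\<^sup>2 \<le> (norm x)\<^sup>2"
      using Basis_le_norm[of b x] by (metis abs_le_square_iff abs_norm_cancel)
    then show "1 + (x \<bullet> b)\<^sup>2 \<le> (1 + norm x)\<^sup>2"
      by (simp add: power2_sum add_increasing2)
  qed simp
  also have "\<dots> = (1 + norm x) ^ (2 * DIM(real^'n))"
    by (simp add: power_mult)
  finally have "inverse (weight x) \<le> (1 + norm x) ^ (2 * DIM(real^'n))"
    unfolding weight_def by (simp add: prod_inversef[symmetric] o_def)
  moreover have "weight x > 0"
    unfolding weight_def by (intro prod_pos) (simp add: add_pos_nonneg)
  ultimately show ?thesis
    by (simp add: field_simps)
qed

lemma le_weightI: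
  fixes x :: "real^'n"
  assumes "(1 + norm x) ^ (2 * DIM(real^'n)) * c \<le> B" "0 \<le> c"
  shows "c \<le> B * weight x"
proof -
  have "c \<le> (1 + norm x) ^ (2 * DIM(real^'n)) * weight x * c"
    using mult_right_mono[OF weight_lower assms(2)] by simp
  also have "\<dots> = ((1 + norm x) ^ (2 * DIM(real^'n)) * c) * weight x"
    by simp
  also have "\<dots> \<le> B * weight x"
    by (intro mult_right_mono assms weight_nonneg)
  finally show ?thesis .
qed

lemma schwartz_continuous: "schwartz f \<Longrightarrow> continuous_on UNIV f"
  by (simp add: continuous_at_imp_continuous_on differentiable_imp_continuous_within schwartz_differentiable)

lemma schwartz_borel: "schwartz f \<Longrightarrow> f \<in> borel_measurable borel"
  by (intro borel_measurable_continuous_onI schwartz_continuous)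

lemma schwartz_bounded: "schwartz f \<Longrightarrow> \<exists>B. \<forall>x. norm (f x) \<le> B"
  using schwartz_decay[of f 0] by simp

lemma schwartz_le_weight: "schwartz f \<Longrightarrow> \<exists>B. \<forall>x. norm (f x) \<le> B * weight x"
  using schwartz_decay' le_weightI norm_ge_zero by metis

lemma borel_measurable_lebesgueI: "f \<in> borel_measurable borel \<Longrightarrow> f \<in> borel_measurable lebesgue"
  by (simp add: measurable_completion)

lemma schwartz_integrable:
  assumes "schwartz f"
  shows "integrable lebesgue f"
proof -
  obtain B where B: "\<And>x. norm (f x) \<le> B * weight x" using schwartz_le_weight[OF assms] by blast
  show ?thesis
  proof (rule Bochner_Integration.integrable_bound)
    show "integrable lebesgue (\<lambda>x::real^'n. B * weight x)"
      by (intro integrable_mult_right integrable_weight)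
    show "AE x in lebesgue. norm (f x) \<le> norm (B * weight x)"
      using B by (auto intro!: AE_I2 order_trans[OF B])
  qed (intro borel_measurable_lebesgueI schwartz_borel assms)
qed

lemma fourier_integrable:
  assumes "schwartz f"
  shows "integrable lebesgue (\<lambda>x. cis (- (x \<bullet> \<xi>)) * f x)"
proof (rule Bochner_Integration.integrable_bound[OF schwartz_integrable[OF assms]])
  have "(\<lambda>x. cis (- (x \<bullet> \<xi>)) * f x) \<in> borel_measurable borel"
    by (intro borel_measurable_continuous_onI continuous_intros schwartz_continuous assms)
  then show "(\<lambda>x. cis (- (x \<bullet> \<xi>)) * f x) \<in> borel_measurable lebesgue"
    by (rule borel_measurable_lebesgueI)
qed (simp add: norm_mult)

lemma fourier_add:
  assumes "schwartz f" "schwartz g"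
  shows "fourier (\<lambda>x. f x + g x) \<xi> = fourier f \<xi> + fourier g \<xi>"
  unfolding fourier_def
  by (simp add: distrib_left fourier_integrable assms)

lemma fourier_cmult: "fourier (\<lambda>x. c * f x) \<xi> = c * fourier f \<xi>"
proof -
  have "(LINT x|lebesgue. cis (- (x \<bullet> \<xi>)) * (c * f x)) = (LINT x|lebesgue. c * (cis (- (x \<bullet> \<xi>)) * f x))"
    by (simp add: mult.left_commute)
  then show ?thesis
    unfolding fourier_def by simp
qed

lemma fourier_zero: "fourier (\<lambda>x. 0) \<xi> = 0"
  using fourier_cmult[of 0 "\<lambda>x. 0" \<xi>] by simp

lemma fourier_sum:
  assumes "finite I" "\<And>i. i \<in> I \<Longrightarrow> schwartz (g i)"
  shows "fourier (\<lambda>x. \<Sum>i\<in>I. g i x) \<xi> = (\<Sum>i\<in>I. fourier (g i) \<xi>)"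
  using assms by (induction I rule: finite_induct) (auto simp: fourier_zero fourier_add schwartz_sum)

lemma fourier_bounded:
  assumes "schwartz f"
  shows "\<exists>B. \<forall>\<xi>. norm (fourier f \<xi>) \<le> B"
proof (intro exI allI)
  fix \<xi> :: "real^'a"
  have "norm (LINT x|lebesgue. cis (- (x \<bullet> \<xi>)) * f x) \<le> (LINT x|lebesgue. norm (f x))"
    using integral_norm_bound[of lebesgue "\<lambda>x. cis (- (x \<bullet> \<xi>)) * f x"] by (simp add: norm_mult)
  then show "norm (fourier f \<xi>) \<le> (2 * pi) powr (- real CARD('a) / 2) * (LINT x|lebesgue. norm (f x))"
    unfolding fourier_def by (simp add: norm_mult mult_left_mono)
qed

section \<open>The Fourier transform and differentiation\<close>

lemma line_has_vector_derivative:
  assumes "\<And>x. f differentiable (at x)"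
  shows "((\<lambda>t. f (x + t *\<^sub>R axis j 1)) has_vector_derivative pd j f (x + t *\<^sub>R axis j 1)) (at t)"
proof -
  have 1: "((\<lambda>t. x + t *\<^sub>R axis j 1) has_derivative (\<lambda>t. t *\<^sub>R axis j 1)) (at t)"
    by (auto intro!: derivative_eq_intros)
  have d: "(f has_derivative frechet_derivative f (at (x + t *\<^sub>R axis j 1))) (at (x + t *\<^sub>R axis j 1))"
    using assms frechet_derivative_works by blast
  have "((\<lambda>t. f (x + t *\<^sub>R axis j 1)) has_derivative
     (\<lambda>t'. frechet_derivative f (at (x + t *\<^sub>R axis j 1)) (t' *\<^sub>R axis j 1))) (at t)"
    by (rule has_derivative_compose[OF 1 d])
  then show ?thesis
    unfolding has_vector_derivative_def pd_def
    by (simp add: linear_cmul[OF has_derivative_linear[OF d]])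
qed

lemma line_difference_bound:
  fixes f :: "real \<Rightarrow> complex"
  assumes "0 < h" "\<And>t. (f has_vector_derivative f' t) (at t)"
    "\<And>t. 0 < t \<Longrightarrow> t < h \<Longrightarrow> norm (f' t) \<le> B"
  shows "norm (f h - f 0) \<le> h * B"
proof -
  have "\<exists>t\<in>{0<..<h}. norm (f h - f 0) \<le> norm ((\<lambda>s. s *\<^sub>R f' t) (h - 0))"
    using assms(1,2)
    by (intro mvt_general continuous_at_imp_continuous_on)
      (auto simp: has_vector_derivative_def intro: has_derivative_continuous)
  then show ?thesis
    using assms(1,3) by (auto intro: order_trans mult_left_mono)
qed

text \<open>Translation invariance of Lebesgue measure; it gives the transform of a difference
  quotient in closed form.\<close>

lemma fourier_translate:
  assumes "schwartz f"
  shows "(LINT x|lebesgue. cis (- (x \<bullet> \<xi>)) * f (x + a)) = cis (a \<bullet> \<xi>) * (LINT x|lebesgue. cis (- (x \<bullet> \<xi>)) * f x)"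
proof -
  let ?g = "\<lambda>x. cis (- ((x - a) \<bullet> \<xi>)) * f x"
  have [measurable]: "f \<in> borel_measurable borel" by (rule schwartz_borel[OF assms])
  have [measurable]: "(\<lambda>x. cis (- (x \<bullet> \<xi>))) \<in> borel_measurable borel" "(\<lambda>x. cis (- ((x - a) \<bullet> \<xi>))) \<in> borel_measurable borel"
    by (intro borel_measurable_continuous_onI continuous_intros)+
  have "(LINT x|lebesgue. cis (- (x \<bullet> \<xi>)) * f (x + a)) = (LINT x|lborel. ?g (a + x))"
    by (subst integral_completion) (simp_all add: add.commute)
  also have "\<dots> = (LINT x|distr lborel borel ((+) a). ?g x)"
    by (subst integral_distr) auto
  also have "\<dots> = (LINT x|lebesgue. ?g x)"
    unfolding lborel_distr_plus by (subst integral_completion) auto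
  also have "\<dots> = (LINT x|lebesgue. cis (a \<bullet> \<xi>) * (cis (- (x \<bullet> \<xi>)) * f x))"
    by (simp add: cis_mult[symmetric] inner_diff_left cis_divide[symmetric] mult.assoc[symmetric] cis_mult)
  finally show ?thesis by simp
qed

text \<open>In place of an integration by parts, the difference quotients in direction
  \<open>j\<close> converge under the integral by dominated convergence, while their transforms are
  known exactly from the translation rule.\<close>

lemma fourier_pd:
  assumes f: "schwartz f"
  shows "fourier (pd j f) \<xi> = \<i> * of_real (\<xi> $ j) * fourier f \<xi>"
proof -
  define h where "h = (\<lambda>n. inverse (real (Suc n)))"
  have h: "0 < h n" "h n \<le> 1" for n by (auto simp: h_def field_simps)
  have h0: "filterlim h (at 0) sequentially"
    unfolding filterlim_at using LIMSEQ_inverse_real_of_nat h(1)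
    by (auto simp: h_def intro!: always_eventually)
  let ?e = "axis j 1 :: real^'a"
  let ?N = "2 * DIM(real^'a)"
  define q where "q = (\<lambda>n x. cis (- (x \<bullet> \<xi>)) * ((f (x + h n *\<^sub>R ?e) - f x) / of_real (h n)))"
  note ld = line_has_vector_derivative[OF schwartz_differentiable[OF f]]
  obtain B where B: "\<And>x. (1 + norm x) ^ ?N * norm (pd j f x) \<le> B"
    using schwartz_decay'[OF schwartz_pd[OF f]] by blast
  \<comment> \<open>The steps \<open>h n\<close> are at most 1, so a point \<open>?y\<close> of the
    segment satisfies \<open>1 + norm x <= 2 * (1 + norm ?y)\<close>; this is the origin of the
    factor \<open>2 ^ ?N\<close>. The majorant does not depend on \<open>n\<close>.\<close>
  have bound: "norm (q n x) \<le> 2 ^ ?N * B * weight x" for n x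
  proof -
    have "norm (f (x + h n *\<^sub>R ?e) - f (x + 0 *\<^sub>R ?e)) \<le> h n * (2 ^ ?N * B * weight x)"
    proof (rule line_difference_bound[OF h(1) ld])
      fix t assume t: "0 < t" "t < h n"
      let ?y = "x + t *\<^sub>R ?e"
      have "norm x \<le> norm ?y + norm (t *\<^sub>R ?e)"
        by (metis add_diff_cancel_right' norm_triangle_sub norm_minus_commute norm_triangle_ineq4)
      moreover have "norm (t *\<^sub>R ?e) \<le> 1" using t h(2)[of n] by simp
      ultimately have "norm x \<le> norm ?y + 1"
        by (rule order_trans[OF _ add_left_mono])
      also have "\<dots> \<le> 2 * norm ?y + 1" by simp
      finally have "1 + norm x \<le> 2 * (1 + norm ?y)"
        by (simp add: algebra_simps)
      then have "(1 + norm x) ^ ?N \<le> (2 * (1 + norm ?y)) ^ ?N"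
        by (rule power_mono) simp
      then have "(1 + norm x) ^ ?N * norm (pd j f ?y) \<le> 2 ^ ?N * (1 + norm ?y) ^ ?N * norm (pd j f ?y)"
        unfolding power_mult_distrib by (rule mult_right_mono) simp
      also have "\<dots> \<le> 2 ^ ?N * B" using B[of ?y] by (simp add: mult.assoc)
      finally show "norm (pd j f ?y) \<le> 2 ^ ?N * B * weight x"
        by (rule le_weightI) simp
    qed
    then show ?thesis
      using h(1)[of n] by (simp add: q_def norm_mult norm_divide pos_divide_le_eq mult.commute)
  qed
  have lim: "(\<lambda>n. q n x) \<longlonglongrightarrow> cis (- (x \<bullet> \<xi>)) * pd j f x" for x
  proof -
    have "((\<lambda>t. norm (f (x + t *\<^sub>R ?e) - f x - t *\<^sub>R pd j f x) / norm t) \<longlongrightarrow> 0) (at 0)"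
      using ld[of x j 0] by (simp add: has_vector_derivative_def has_derivative_at)
    then have "(\<lambda>n. norm (f (x + h n *\<^sub>R ?e) - f x - h n *\<^sub>R pd j f x) / norm (h n)) \<longlonglongrightarrow> 0"
      by (rule filterlim_compose[OF _ h0])
    moreover have "norm (f (x + h n *\<^sub>R ?e) - f x - h n *\<^sub>R pd j f x) / norm (h n) =
        norm ((f (x + h n *\<^sub>R ?e) - f x) / of_real (h n) - pd j f x)" for n
    proof -
      have "(f (x + h n *\<^sub>R ?e) - f x) / of_real (h n) - pd j f x =
        (f (x + h n *\<^sub>R ?e) - f x - h n *\<^sub>R pd j f x) / of_real (h n)"
        using h(1)[of n] by (simp add: field_simps scaleR_conv_of_real)
      then show ?thesis by (simp add: norm_divide)
    qed
    ultimately have "(\<lambda>n. (f (x + h n *\<^sub>R ?e) - f x) / of_real (h n)) \<longlonglongrightarrow> pd j f x"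
      by (simp add: tendsto_norm_zero_iff LIM_zero_iff)
    then show ?thesis unfolding q_def by (intro tendsto_intros)
  qed
  have qm: "q n \<in> borel_measurable lebesgue" for n
    unfolding q_def
    by (intro borel_measurable_lebesgueI borel_measurable_continuous_onI continuous_intros
        continuous_on_compose2[OF schwartz_continuous[OF f]])
      (auto simp: h(1)[THEN less_imp_neq, THEN not_sym])
  have "(\<lambda>n. LINT x|lebesgue. q n x) \<longlonglongrightarrow> (LINT x|lebesgue. cis (- (x \<bullet> \<xi>)) * pd j f x)"
  proof (rule integral_dominated_convergence)
    show "(\<lambda>x. cis (- (x \<bullet> \<xi>)) * pd j f x) \<in> borel_measurable lebesgue"
      using fourier_integrable[OF schwartz_pd[OF f]] by (rule borel_measurable_integrable)
    show "q n \<in> borel_measurable lebesgue" for n by (rule qm)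
    show "integrable lebesgue (\<lambda>x::real^'a. 2 ^ ?N * B * weight x)"
      by (intro integrable_mult_right integrable_weight)
  qed (use bound lim in auto)
  moreover have "(LINT x|lebesgue. q n x) =
      ((cis (h n * \<xi> $ j) - 1) / of_real (h n)) * (LINT x|lebesgue. cis (- (x \<bullet> \<xi>)) * f x)" for n
  proof -
    \<comment> \<open>The translate is recovered from the quotient, which has an integrable
      majorant, and from \<open>f\<close> itself.\<close>
    have sh: "integrable lebesgue (\<lambda>x. cis (- (x \<bullet> \<xi>)) * f (x + h n *\<^sub>R ?e))"
    proof (rule Bochner_Integration.integrable_bound)
      have "integrable lebesgue (\<lambda>x. h n *\<^sub>R q n x + cis (- (x \<bullet> \<xi>)) * f x)"
      proof (intro Bochner_Integration.integrable_add fourier_integrable f integrable_scaleR_right)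
        show "integrable lebesgue (q n)"
        proof (rule Bochner_Integration.integrable_bound)
          show "integrable lebesgue (\<lambda>x::real^'a. 2 ^ ?N * B * weight x)"
            by (intro integrable_mult_right integrable_weight)
          show "q n \<in> borel_measurable lebesgue" by (rule qm)
          show "AE x in lebesgue. norm (q n x) \<le> norm (2 ^ ?N * B * weight x)"
            unfolding real_norm_def by (intro AE_I2 order_trans[OF bound abs_ge_self])
        qed
      qed
      moreover have "h n *\<^sub>R q n x + cis (- (x \<bullet> \<xi>)) * f x = cis (- (x \<bullet> \<xi>)) * f (x + h n *\<^sub>R ?e)" for x
        using h(1)[of n] by (simp add: q_def scaleR_conv_of_real field_simps)
      ultimately show "integrable lebesgue (\<lambda>x. cis (- (x \<bullet> \<xi>)) * f (x + h n *\<^sub>R ?e))" by simp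
      then show "(\<lambda>x. cis (- (x \<bullet> \<xi>)) * f (x + h n *\<^sub>R ?e)) \<in> borel_measurable lebesgue" by simp
    qed simp
    have "(LINT x|lebesgue. q n x) = (LINT x|lebesgue. (cis (- (x \<bullet> \<xi>)) * f (x + h n *\<^sub>R ?e) - cis (- (x \<bullet> \<xi>)) * f x) / of_real (h n))"
      unfolding q_def by (simp add: right_diff_distrib)
    also have "\<dots> = ((LINT x|lebesgue. cis (- (x \<bullet> \<xi>)) * f (x + h n *\<^sub>R ?e)) - (LINT x|lebesgue. cis (- (x \<bullet> \<xi>)) * f x)) / of_real (h n)"
      using sh fourier_integrable[OF f] by simp
    finally show ?thesis
      unfolding fourier_translate[OF f] by (simp add: inner_axis' field_simps)
  qed
  \<comment> \<open>The factor produced by translation is the difference quotient of an exponential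
    at 0.\<close>
  moreover have "(\<lambda>n. (cis (h n * \<xi> $ j) - 1) / of_real (h n)) \<longlonglongrightarrow> \<i> * of_real (\<xi> $ j)"
  proof -
    have "((\<lambda>t. exp (\<i> * of_real (\<xi> $ j) * t)) has_field_derivative \<i> * of_real (\<xi> $ j)) (at 0)"
      by (auto intro!: derivative_eq_intros)
    then have l: "((\<lambda>t. (exp (\<i> * of_real (\<xi> $ j) * t) - 1) / t) \<longlongrightarrow> \<i> * of_real (\<xi> $ j)) (at 0)"
      by (simp add: has_field_derivative_iff)
    have "filterlim (\<lambda>n. complex_of_real (h n)) (at 0) sequentially"
      unfolding filterlim_at
    proof
      show "\<forall>\<^sub>F n in sequentially. complex_of_real (h n) \<in> UNIV \<and> complex_of_real (h n) \<noteq> 0"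
        using h(1) by (intro always_eventually) (metis UNIV_I of_real_eq_0_iff less_irrefl)
      show "(\<lambda>n. complex_of_real (h n)) \<longlonglongrightarrow> 0"
        using h0 unfolding filterlim_at by (metis tendsto_of_real of_real_0)
    qed
    from filterlim_compose[OF l this] show ?thesis
      by (simp add: cis_conv_exp mult_ac)
  qed
  ultimately have "(LINT x|lebesgue. cis (- (x \<bullet> \<xi>)) * pd j f x) =
      \<i> * of_real (\<xi> $ j) * (LINT x|lebesgue. cis (- (x \<bullet> \<xi>)) * f x)"
    by (simp only:) (rule LIMSEQ_unique, assumption, rule tendsto_mult_right)
  then show ?thesis unfolding fourier_def by simp
qed

lemma schwartz_uminus: "schwartz f \<Longrightarrow> schwartz (\<lambda>x. - f x)"
  using schwartz_cmult[of f "- 1"] by simp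

lemma cis_second_order: "norm (cis t - 1 - \<i> * of_real t) \<le> t\<^sup>2"
proof -
  have "norm (exp (\<i> * of_real t) - (\<Sum>k\<le>1. (\<i> * of_real t) ^ k / fact k)) \<le> \<bar>t\<bar> ^ Suc 1 / fact (Suc 1)"
    using iexp_approx1[of t 1] by simp
  also have "\<dots> \<le> t\<^sup>2" by (simp add: power2_eq_square)
  finally show ?thesis by (simp add: cis_conv_exp diff_diff_eq)
qed

text \<open>The first-order Taylor error of \<open>cis\<close> is at most
  \<open>(x \<bullet> h)^2\<close>. Since \<open>(norm x)^2 * norm (f x)\<close> has an integrable
  majorant, the error of the transform is quadratic in \<open>h\<close>.\<close>

lemma fourier_has_derivative:
  fixes f :: "real^'n \<Rightarrow> complex"
  assumes f: "schwartz f"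
  shows "(fourier f has_derivative
    (\<lambda>h. \<Sum>j\<in>UNIV. of_real (h $ j) * fourier (\<lambda>x. - \<i> * (of_real (x $ j) * f x)) \<xi>)) (at \<xi>)"
proof -
  let ?c = "(2 * pi) powr (- real CARD('n) / 2)"
  let ?g = "\<lambda>j x. - \<i> * (of_real (x $ j) * f x)"
  let ?D = "\<lambda>h. \<Sum>j\<in>UNIV. of_real (h $ j) * fourier (?g j) \<xi>"
  have g: "schwartz (?g j)" for j
    by (intro schwartz_cmult schwartz_coordinate_mult f)
  \<comment> \<open>Two powers more than integrability asks for: they pay for the factor
    \<open>(norm x)^2\<close> in the Taylor error.\<close>
  obtain B where B: "\<And>x. (1 + norm x) ^ (2 * DIM(real^'n) + 2) * norm (f x) \<le> B"
    using schwartz_decay'[OF f] by blast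
  have Bw: "(norm x)\<^sup>2 * norm (f x) \<le> B * weight x" for x
  proof (rule le_weightI)
    have "(norm x)\<^sup>2 \<le> (1 + norm x)\<^sup>2" by (rule power_mono) auto
    then have "(1 + norm x) ^ (2 * DIM(real^'n)) * ((norm x)\<^sup>2 * norm (f x)) \<le>
        (1 + norm x) ^ (2 * DIM(real^'n)) * ((1 + norm x)\<^sup>2 * norm (f x))"
      by (intro mult_left_mono mult_right_mono) auto
    also have "\<dots> \<le> B" using B[of x] by (simp only: power_add mult.assoc)
    finally show "(1 + norm x) ^ (2 * DIM(real^'n)) * ((norm x)\<^sup>2 * norm (f x)) \<le> B" .
  qed simp
  define I where "I = (LINT x|lebesgue. B * weight (x :: real^'n))"
  have remainder: "norm (fourier f (\<xi> + h) - fourier f \<xi> - ?D h) \<le> ?c * I * (norm h)\<^sup>2" for h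
  proof -
    \<comment> \<open>The integrand of the error; it factors into
      \<open>cis (- (x \<bullet> \<xi>))\<close>, the Taylor error of \<open>cis\<close> at
      \<open>- (x \<bullet> h)\<close>, and \<open>f x\<close>.\<close>
    let ?r = "\<lambda>x. cis (- (x \<bullet> (\<xi> + h))) * f x - cis (- (x \<bullet> \<xi>)) * f x -
       (\<Sum>j\<in>UNIV. of_real (h $ j) * (cis (- (x \<bullet> \<xi>)) * ?g j x))"
    have int: "integrable lebesgue (\<lambda>x. cis (- (x \<bullet> \<xi>)) * ?g j x)" for j
      by (rule fourier_integrable[OF g])
    have int': "integrable lebesgue (\<lambda>x. of_real (h $ j) * (cis (- (x \<bullet> \<xi>)) * ?g j x))" for j
      by (rule integrable_mult_right) (rule int)
    have "(LINT x|lebesgue. (\<Sum>j\<in>UNIV. of_real (h $ j) * (cis (- (x \<bullet> \<xi>)) * ?g j x))) =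
        (\<Sum>j\<in>UNIV. LINT x|lebesgue. of_real (h $ j) * (cis (- (x \<bullet> \<xi>)) * ?g j x))"
      by (rule Bochner_Integration.integral_sum) (rule int')
    then have sum: "(LINT x|lebesgue. (\<Sum>j\<in>UNIV. of_real (h $ j) * (cis (- (x \<bullet> \<xi>)) * ?g j x))) =
        (\<Sum>j\<in>UNIV. of_real (h $ j) * (LINT x|lebesgue. cis (- (x \<bullet> \<xi>)) * ?g j x))"
      unfolding integral_mult_right_zero .
    have "(LINT x|lebesgue. ?r x) = (LINT x|lebesgue. cis (- (x \<bullet> (\<xi> + h))) * f x) -
        (LINT x|lebesgue. cis (- (x \<bullet> \<xi>)) * f x) -
        (\<Sum>j\<in>UNIV. of_real (h $ j) * (LINT x|lebesgue. cis (- (x \<bullet> \<xi>)) * ?g j x))"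
      unfolding sum[symmetric]
        Bochner_Integration.integral_diff[OF fourier_integrable[OF f] fourier_integrable[OF f], symmetric]
      by (rule Bochner_Integration.integral_diff)
        (intro Bochner_Integration.integrable_diff Bochner_Integration.integrable_sum fourier_integrable f int')+
    then have eq: "fourier f (\<xi> + h) - fourier f \<xi> - ?D h = of_real ?c * (LINT x|lebesgue. ?r x)"
      unfolding fourier_def by (simp only: right_diff_distrib sum_distrib_left mult.left_commute)
    have "norm (LINT x|lebesgue. ?r x) \<le> (LINT x|lebesgue. norm (?r x))"
      by (rule Bochner_Integration.integral_norm_bound)
    also have "\<dots> \<le> (LINT x|lebesgue. (norm h)\<^sup>2 * (B * weight (x :: real^'n)))"
    proof (rule Bochner_Integration.integral_mono)
      show "integrable lebesgue (\<lambda>x. norm (?r x))"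
        by (intro integrable_norm Bochner_Integration.integrable_diff Bochner_Integration.integrable_sum
          fourier_integrable f int')
      show "integrable lebesgue (\<lambda>x::real^'n. (norm h)\<^sup>2 * (B * weight x))"
        by (intro integrable_mult_right integrable_weight)
      fix x :: "real^'n"
      have "(\<Sum>j\<in>UNIV. of_real (h $ j) * (cis (- (x \<bullet> \<xi>)) * ?g j x)) =
          cis (- (x \<bullet> \<xi>)) * (\<i> * of_real (- (x \<bullet> h))) * f x"
        by (simp add: inner_vec_def sum_distrib_left sum_distrib_right mult_ac sum_negf)
      moreover have "cis (- (x \<bullet> (\<xi> + h))) = cis (- (x \<bullet> \<xi>)) * cis (- (x \<bullet> h))"
        by (simp add: cis_mult inner_add_right)
      ultimately have "?r x = cis (- (x \<bullet> \<xi>)) * (cis (- (x \<bullet> h)) - 1 - \<i> * of_real (- (x \<bullet> h))) * f x"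
        by (simp only: left_diff_distrib right_diff_distrib mult_1_right)
      then have "norm (?r x) = norm (cis (- (x \<bullet> h)) - 1 - \<i> * of_real (- (x \<bullet> h))) * norm (f x)"
        by (simp only: norm_mult norm_cis mult_1_left)
      also have "\<dots> \<le> (- (x \<bullet> h))\<^sup>2 * norm (f x)"
        by (intro mult_right_mono cis_second_order) simp
      also have "\<dots> \<le> ((norm x) * (norm h))\<^sup>2 * norm (f x)"
        by (intro mult_right_mono) (auto simp: Cauchy_Schwarz_ineq2 abs_le_square_iff[symmetric])
      also have "\<dots> \<le> (norm h)\<^sup>2 * (B * weight x)"
        using mult_left_mono[OF Bw[of x], of "(norm h)\<^sup>2"] by (simp add: power_mult_distrib mult_ac)
      finally show "norm (?r x) \<le> (norm h)\<^sup>2 * (B * weight x)" .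
    qed
    also have "\<dots> = (norm h)\<^sup>2 * I" unfolding I_def by (rule integral_mult_right_zero)
    finally show ?thesis
      unfolding eq by (simp add: norm_mult mult_left_mono mult_ac)
  qed
  have "bounded_linear ?D"
    by (intro bounded_linear_sum bounded_linear_mult_const bounded_linear_compose[OF bounded_linear_of_real]
        bounded_linear_vec_nth)
  moreover have "(\<lambda>h. norm (fourier f (\<xi> + h) - fourier f \<xi> - ?D h) / norm h) \<midarrow>0\<rightarrow> 0"
  proof (rule Lim_null_comparison)
    show "\<forall>\<^sub>F h in at 0. norm (norm (fourier f (\<xi> + h) - fourier f \<xi> - ?D h) / norm h) \<le> ?c * I * norm h"
    proof (rule eventually_at_filter[THEN iffD2], rule always_eventually, intro allI impI)
      fix h :: "real^'n" assume "h \<noteq> 0"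
      then show "norm (norm (fourier f (\<xi> + h) - fourier f \<xi> - ?D h) / norm h) \<le> ?c * I * norm h"
        using remainder[of h] by (simp add: divide_le_eq power2_eq_square mult_ac)
    qed
    show "(\<lambda>h::real^'n. ?c * I * norm h) \<midarrow>0\<rightarrow> 0"
      by (auto intro!: tendsto_eq_intros)
  qed
  ultimately show ?thesis by (simp add: has_derivative_at)
qed

lemma fourier_differentiable: "schwartz f \<Longrightarrow> fourier f differentiable (at \<xi>)"
  using fourier_has_derivative differentiable_def by blast

lemma pd_fourier:
  assumes "schwartz f"
  shows "pd j (fourier f) = fourier (\<lambda>x. - \<i> * (of_real (x $ j) * f x))"
proof
  fix \<xi>
  show "pd j (fourier f) \<xi> = fourier (\<lambda>x. - \<i> * (of_real (x $ j) * f x)) \<xi>"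
    unfolding pd_eqI[OF fourier_has_derivative[OF assms]]
    by (subst sum.remove[of _ j]) (auto simp: axis_def intro!: sum.neutral)
qed

text \<open>Every power of \<open>norm \<xi>\<close> costs one derivative of \<open>f\<close>: it is
  at most the sum of the \<open>\<bar>\<xi> $ j\<bar>\<close>, and each coordinate is absorbed into
  the transform of \<open>pd j f\<close>.\<close>

lemma fourier_decay:
  fixes f :: "real^'n \<Rightarrow> complex"
  assumes "schwartz f"
  shows "\<exists>B. \<forall>\<xi>. norm \<xi> ^ k * norm (fourier f \<xi>) \<le> B"
  using assms
proof (induction k arbitrary: f)
  case 0
  then show ?case using fourier_bounded by simp
next
  case (Suc k)
  have "\<forall>j. \<exists>B. \<forall>\<xi>. norm \<xi> ^ k * norm (fourier (pd j f) \<xi>) \<le> B"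
    using Suc schwartz_pd by blast
  then obtain B where B: "\<And>j \<xi>. norm \<xi> ^ k * norm (fourier (pd j f) \<xi>) \<le> B j" by metis
  have "norm \<xi> ^ Suc k * norm (fourier f \<xi>) \<le> (\<Sum>j\<in>UNIV. B j)" for \<xi>
  proof -
    have "norm \<xi> ^ Suc k * norm (fourier f \<xi>) \<le> norm \<xi> ^ k * (\<Sum>j\<in>UNIV. \<bar>\<xi> $ j\<bar>) * norm (fourier f \<xi>)"
      using norm_le_l1_cart[of \<xi>] by (simp add: mult.commute[of "norm \<xi>"] mult_left_mono mult_right_mono)
    also have "\<dots> = (\<Sum>j\<in>UNIV. norm \<xi> ^ k * norm (fourier (pd j f) \<xi>))"
      by (simp add: fourier_pd[OF Suc.prems] norm_mult sum_distrib_left sum_distrib_right mult_ac)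
    also have "\<dots> \<le> (\<Sum>j\<in>UNIV. B j)" by (intro sum_mono B)
    finally show ?thesis .
  qed
  then show ?case by blast
qed

text \<open>The transforms of Schwartz functions form a class closed under \<open>pd\<close>,
  because \<open>pd\<close> becomes multiplication by a coordinate before the transform.\<close>

lemma schwartz_fourier: "schwartz f \<Longrightarrow> schwartz (fourier f)"
  by (rule schwartz_coinduct[where F="fourier ` Collect schwartz"])
    (auto simp: pd_fourier
      intro!: fourier_differentiable fourier_decay imageI schwartz_uminus schwartz_cmult schwartz_coordinate_mult)

section \<open>Symmetry of second derivatives\<close>

lemma second_difference:
  fixes f :: "real^'n \<Rightarrow> complex"
  assumes f: "\<And>x. f differentiable (at x)" and g: "pd i f differentiable (at x)" and "0 < e"
  shows "\<exists>d>0. \<forall>h. 0 < h \<longrightarrow> h < d \<longrightarrow>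
    norm ((f (x + h *\<^sub>R axis i 1 + h *\<^sub>R axis j 1) - f (x + h *\<^sub>R axis i 1) - f (x + h *\<^sub>R axis j 1) + f x)
      - (h * h) *\<^sub>R pd j (pd i f) x) \<le> e * (h * h)"
proof -
  let ?ei = "axis i 1 :: real^'n" and ?ej = "axis j 1 :: real^'n"
  let ?g = "frechet_derivative (pd i f) (at x)"
  have dg: "(pd i f has_derivative ?g) (at x)" using g frechet_derivative_works by blast
  then have lin: "linear ?g" by (rule has_derivative_linear)
  \<comment> \<open>The expansion will be used at two points at distance at most
    \<open>2 * h\<close> and \<open>h\<close> from \<open>x\<close>. Hence the share
    \<open>e / 3\<close>, and below the restriction \<open>h < d / 2\<close>.\<close>
  obtain d where d: "d > 0" "\<And>y. norm (y - x) < d \<Longrightarrow>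
      norm (pd i f y - pd i f x - ?g (y - x)) \<le> e / 3 * norm (y - x)"
    using dg \<open>0 < e\<close> unfolding has_derivative_at_alt by (meson divide_pos_pos zero_less_numeral)
  have "norm ((f (x + h *\<^sub>R ?ei + h *\<^sub>R ?ej) - f (x + h *\<^sub>R ?ei) - f (x + h *\<^sub>R ?ej) + f x)
      - (h * h) *\<^sub>R pd j (pd i f) x) \<le> e * (h * h)" if h: "0 < h" "h < d / 2" for h
  proof -
    \<comment> \<open>The second difference is the increment over \<open>{0..h}\<close> of a
      function of one variable; the last term subtracts its expected value, so that the mean value
      inequality estimates the error directly.\<close>
    let ?p = "\<lambda>s. f (x + h *\<^sub>R ?ej + s *\<^sub>R ?ei) - f (x + s *\<^sub>R ?ei) - s *\<^sub>R (h *\<^sub>R ?g ?ej)"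
    let ?p' = "\<lambda>s. pd i f (x + h *\<^sub>R ?ej + s *\<^sub>R ?ei) - pd i f (x + s *\<^sub>R ?ei) - h *\<^sub>R ?g ?ej"
    have "norm (?p h - ?p 0) \<le> h * (e * h)"
    proof (rule line_difference_bound[of h ?p ?p', OF h(1)])
      show "(?p has_vector_derivative ?p' s) (at s)" for s
        by (intro has_vector_derivative_diff line_has_vector_derivative f)
          (auto intro!: derivative_eq_intros)
      fix s assume s: "0 < s" "s < h"
      let ?y = "x + h *\<^sub>R ?ej + s *\<^sub>R ?ei" and ?z = "x + s *\<^sub>R ?ei"
      have "norm (h *\<^sub>R ?ej + s *\<^sub>R ?ei) \<le> norm (h *\<^sub>R ?ej) + norm (s *\<^sub>R ?ei)" by (rule norm_triangle_ineq)
      then have ny: "norm (?y - x) \<le> 2 * h" using s h(1) by (simp add: add.assoc)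
      have nz: "norm (?z - x) \<le> h" using s by simp
      have "?p' s = (pd i f ?y - pd i f x - ?g (?y - x)) - (pd i f ?z - pd i f x - ?g (?z - x))"
        by (simp add: add.assoc linear_add[OF lin] linear_cmul[OF lin])
      then have "norm (?p' s) \<le> norm (pd i f ?y - pd i f x - ?g (?y - x)) + norm (pd i f ?z - pd i f x - ?g (?z - x))"
        by (simp only: norm_triangle_ineq4)
      also have "\<dots> \<le> e / 3 * norm (?y - x) + e / 3 * norm (?z - x)"
        by (intro add_mono d(2) le_less_trans[OF ny] le_less_trans[OF nz]) (use h in auto)
      also have "\<dots> \<le> e / 3 * (2 * h) + e / 3 * h"
        using ny nz \<open>0 < e\<close> by (intro add_mono mult_left_mono) auto
      also have "\<dots> = e * h" by simp
      finally show "norm (?p' s) \<le> e * h" .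
    qed
    moreover have "?p h - ?p 0 = (f (x + h *\<^sub>R ?ei + h *\<^sub>R ?ej) - f (x + h *\<^sub>R ?ei) - f (x + h *\<^sub>R ?ej) + f x)
      - (h * h) *\<^sub>R pd j (pd i f) x"
      by (simp add: pd_def[of j "pd i f" x]) (simp add: add_ac)
    ultimately show ?thesis by (simp only: mult.left_commute[of h e h])
  qed
  then show ?thesis using d(1) by (intro exI[of _ "d / 2"]) auto
qed

text \<open>The second difference is symmetric in \<open>i\<close> and \<open>j\<close>, and both
  mixed derivatives approximate it up to \<open>e * (h * h)\<close>. Continuity of second
  derivatives is not assumed.\<close>

lemma pd_commute:
  fixes f :: "real^'n \<Rightarrow> complex"
  assumes "\<And>x. f differentiable (at x)" "\<And>i x. pd i f differentiable (at x)"
  shows "pd i (pd j f) x = pd j (pd i f) x"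
proof (rule ccontr)
  \<comment> \<open>The two approximation errors add up to \<open>2 * e\<close>, against a gap of
    \<open>3 * e\<close>.\<close>
  define e where "e = norm (pd i (pd j f) x - pd j (pd i f) x) / 3"
  assume "pd i (pd j f) x \<noteq> pd j (pd i f) x"
  then have e: "e > 0" by (simp add: e_def)
  define S where "S = (\<lambda>h. f (x + h *\<^sub>R axis i 1 + h *\<^sub>R axis j 1) - f (x + h *\<^sub>R axis i 1) - f (x + h *\<^sub>R axis j 1) + f x)"
  obtain d where d: "d > 0" "\<And>h. 0 < h \<Longrightarrow> h < d \<Longrightarrow> norm (S h - (h * h) *\<^sub>R pd j (pd i f) x) \<le> e * (h * h)"
    using second_difference[OF assms e, where i=i and j=j and x=x] unfolding S_def by blast
  have S: "S h = f (x + h *\<^sub>R axis j 1 + h *\<^sub>R axis i 1) - f (x + h *\<^sub>R axis j 1) - f (x + h *\<^sub>R axis i 1) + f x" for h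
    unfolding S_def by (simp add: add.assoc add.commute[of "h *\<^sub>R axis i 1"])
  obtain d' where d': "d' > 0" "\<And>h. 0 < h \<Longrightarrow> h < d' \<Longrightarrow> norm (S h - (h * h) *\<^sub>R pd i (pd j f) x) \<le> e * (h * h)"
    using second_difference[OF assms e, where i=j and j=i and x=x] unfolding S by blast
  define h where "h = min d d' / 2"
  have h: "0 < h" "h < d" "h < d'" using d(1) d'(1) by (auto simp: h_def)
  have "norm (pd i (pd j f) x - pd j (pd i f) x) = 3 * e" by (simp add: e_def)
  then have "(h * h) * (3 * e) = norm ((h * h) *\<^sub>R (pd i (pd j f) x - pd j (pd i f) x))"
    by (simp only: norm_scaleR) (simp add: abs_mult)
  also have "\<dots> = norm ((S h - (h * h) *\<^sub>R pd j (pd i f) x) - (S h - (h * h) *\<^sub>R pd i (pd j f) x))"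
    unfolding scaleR_diff_right by simp
  also have "\<dots> \<le> e * (h * h) + e * (h * h)"
    by (rule order_trans[OF norm_triangle_ineq4 add_mono[OF d(2) d'(2)]]) (use h in auto)
  also have "\<dots> = (h * h) * (2 * e)" by simp
  finally have "3 * e \<le> 2 * e"
    using h(1) by (simp only: mult_le_cancel_left_pos mult_pos_pos)
  then show False using e by simp
qed

lemma schwartz_pd_commute: "schwartz f \<Longrightarrow> pd i (pd j f) = pd j (pd i f)"
  by (intro ext pd_commute schwartz_differentiable schwartz_pd)

section \<open>Resolvents of affine symbols\<close>

lemma matrix_inv_inverse:
  assumes "invertible A"
  shows "A ** matrix_inv A = mat 1" "matrix_inv A ** A = mat 1"
  using someI_ex[OF assms[unfolded invertible_def]] unfolding matrix_inv_def by auto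

section \<open>Pairing Lebesgue functions with test functions\<close>

lemma norm_vector_smult: "norm (c *s v) = norm c * norm (v :: complex^'m)"
  unfolding norm_vec_def by (simp add: L2_set_right_distrib norm_mult)

lemma continuous_on_vector_smult [continuous_intros]:
  fixes g :: "'a::topological_space \<Rightarrow> complex^'m"
  shows "continuous_on S f \<Longrightarrow> continuous_on S g \<Longrightarrow> continuous_on S (\<lambda>x. f x *s g x)"
  unfolding vector_scalar_mult_def by (intro continuous_intros)

lemma borel_measurable_vector_smult:
  fixes g :: "'a \<Rightarrow> complex^'m"
  assumes "f \<in> borel_measurable M" "g \<in> borel_measurable M"
  shows "(\<lambda>x. f x *s g x) \<in> borel_measurable M"
  by (rule borel_measurable_continuous_Pair[OF assms]) (intro continuous_intros)

lemma Lp_ennreal_iff: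
  assumes "0 \<le> q"
  shows "u \<in> Lp (ennreal q) \<longleftrightarrow>
    u \<in> borel_measurable lebesgue \<and> (\<integral>\<^sup>+x. ennreal (norm (u x) powr q) \<partial>lebesgue) < \<infinity>"
  using assms unfolding Lp_def Lp_norm_def by (auto simp: Let_def less_top)

text \<open>Test functions are integrable and bounded, so the pointwise inequality
  \<open>norm (u x) <= 1 + norm (u x) powr q\<close> gives a majorant at once.\<close>

lemma regular_integrable:
  assumes u: "u \<in> Lp (ennreal q)" and q: "1 \<le> q" and f: "schwartz \<phi>"
  shows "integrable lebesgue (\<lambda>x. \<phi> x *s u x)"
proof -
  have meas: "u \<in> borel_measurable lebesgue" and fin: "(\<integral>\<^sup>+x. ennreal (norm (u x) powr q) \<partial>lebesgue) < \<infinity>"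
    using u q by (auto simp: Lp_ennreal_iff)
  obtain B where B: "\<And>x. norm (\<phi> x) \<le> B" using schwartz_bounded[OF f] by blast
  have uq: "integrable lebesgue (\<lambda>x. norm (u x) powr q)"
    using meas fin by (auto simp: integrable_iff_bounded)
  have "integrable lebesgue (\<lambda>x. norm (\<phi> x) + B * norm (u x) powr q)"
    by (intro Bochner_Integration.integrable_add integrable_norm schwartz_integrable[OF f] integrable_mult_right uq)
  then show ?thesis
  proof (rule Bochner_Integration.integrable_bound)
    show "(\<lambda>x. \<phi> x *s u x) \<in> borel_measurable lebesgue"
      by (intro borel_measurable_vector_smult meas borel_measurable_lebesgueI schwartz_borel f)
    have "norm (\<phi> x *s u x) \<le> norm (\<phi> x) + B * norm (u x) powr q" for x
    proof -
      have "norm (u x) \<le> 1 + norm (u x) powr q"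
      proof (cases "norm (u x) \<le> 1")
        case False
        then have "norm (u x) powr 1 \<le> norm (u x) powr q" using q by (intro powr_mono) auto
        then show ?thesis by simp
      qed (simp add: add_increasing2)
      then have "norm (\<phi> x) * norm (u x) \<le> norm (\<phi> x) * (1 + norm (u x) powr q)"
        by (intro mult_left_mono) auto
      also have "\<dots> \<le> norm (\<phi> x) + B * norm (u x) powr q"
        using mult_right_mono[OF B[of x], of "norm (u x) powr q"] by (simp add: distrib_left)
      finally show ?thesis by (simp add: norm_vector_smult)
    qed
    then show "AE x in lebesgue. norm (\<phi> x *s u x) \<le> norm (norm (\<phi> x) + B * norm (u x) powr q)"
      unfolding real_norm_def by (intro AE_I2) (rule order_trans[OF _ abs_ge_self])
  qed
qed

lemma regular_add:
  assumes "u \<in> Lp (ennreal q)" "1 \<le> q" "schwartz \<phi>" "schwartz \<psi>"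
  shows "regular u (\<lambda>x. \<phi> x + \<psi> x) = regular u \<phi> + regular u \<psi>"
  unfolding regular_def
  by (simp add: vector_sadd_rdistrib Bochner_Integration.integral_add regular_integrable[OF assms(1,2)] assms(3,4))

lemma bounded_linear_vector_smult: "bounded_linear (\<lambda>v :: complex^'m. c *s v)"
  by (rule bounded_linear_intro[where K="norm c"])
    (auto simp: vec_eq_iff norm_vector_smult algebra_simps)

lemma regular_cmult:
  assumes "u \<in> Lp (ennreal q)" "1 \<le> q" "schwartz \<phi>"
  shows "regular u (\<lambda>x. c * \<phi> x) = c *s regular u \<phi>"
  unfolding regular_def vector_smult_assoc[symmetric]
  by (rule integral_bounded_linear[OF bounded_linear_vector_smult regular_integrable[OF assms]])

lemma regular_zero: "regular u (\<lambda>x. 0) = 0"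
  by (simp add: regular_def)

lemma regular_sum:
  assumes "u \<in> Lp (ennreal q)" "1 \<le> q" "finite I" "\<And>i. i \<in> I \<Longrightarrow> schwartz (g i)"
  shows "regular u (\<lambda>x. \<Sum>i\<in>I. g i x) = (\<Sum>i\<in>I. regular u (g i))"
  using assms(3,4)
  by (induction I rule: finite_induct)
    (auto simp: regular_zero regular_add[OF assms(1,2)] schwartz_sum)

text \<open>The properties of a Maxwell symbol on which the inversion rests: affine dependence on
  \<open>\<xi>\<close>, and injectivity with a constant uniform in \<open>\<xi>\<close>.\<close>

locale affine_symbol =
  fixes S :: "real^'n \<Rightarrow> complex^'m^'m" and A0 :: "complex^'m^'m" and A :: "'n \<Rightarrow> complex^'m^'m" and K :: real
  assumes S_eq: "\<And>\<xi> j k. S \<xi> $ j $ k = A0 $ j $ k + (\<Sum>l\<in>UNIV. of_real (\<xi> $ l) * A l $ j $ k)"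
    and S_bound: "\<And>\<xi> v. norm v \<le> K * norm (S \<xi> *v v)"
begin

definition linear_part :: "real^'n \<Rightarrow> complex^'m^'m" where
  "linear_part h = (\<chi> j k. \<Sum>l\<in>UNIV. of_real (h $ l) * A l $ j $ k)"

definition R :: "real^'n \<Rightarrow> complex^'m^'m" where "R \<xi> = matrix_inv (S \<xi>)"

lemma S_add: "S (\<xi> + h) = S \<xi> + linear_part h"
  by (simp add: vec_eq_iff S_eq linear_part_def distrib_right sum.distrib)

lemma linear_part_axis: "linear_part (axis l 1) = A l"
proof -
  have "(\<Sum>l'\<in>UNIV. of_real (axis l 1 $ l' :: real) * A l' $ j $ k) = A l $ j $ k" for j k
    by (subst sum.remove[of _ l]) (auto simp: axis_def intro!: sum.neutral)
  then show ?thesis by (simp add: vec_eq_iff linear_part_def)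
qed

lemma S_invertible: "invertible (S \<xi>)"
proof -
  have "inj ((*v) (S \<xi>))"
  proof (rule injI)
    fix v w assume "S \<xi> *v v = S \<xi> *v w"
    then have "S \<xi> *v (v - w) = 0" by (simp add: matrix_vector_mult_diff_distrib)
    then show "v = w" using S_bound[of "v - w" \<xi>] by simp
  qed
  then show ?thesis by (simp add: invertible_left_inverse matrix_left_invertible_injective)
qed

lemma S_R: "S \<xi> ** R \<xi> = mat 1" and R_S: "R \<xi> ** S \<xi> = mat 1"
  unfolding R_def by (intro matrix_inv_inverse S_invertible)+

lemma S_R_vec: "S \<xi> *v (R \<xi> *v w) = w" and R_S_vec: "R \<xi> *v (S \<xi> *v w) = w"
  by (simp_all add: matrix_vector_mul_assoc S_R R_S)

lemma R_bound: "norm (R \<xi> *v w) \<le> K * norm w"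
  using S_bound[of "R \<xi> *v w" \<xi>] by (simp add: S_R_vec)

text \<open>Follows from the resolvent bound at some unit vector; \<open>undefined\<close> merely
  names an index.\<close>

lemma K_nonneg: "0 \<le> K"
proof -
  have "0 \<le> K * norm (axis undefined 1 :: complex^'m)"
    by (rule order_trans[OF norm_ge_zero R_bound])
  then show ?thesis by simp
qed

lemma linear_linear_part: "linear (\<lambda>h. linear_part h *v w)"
proof (rule linearI)
  fix h h' r
  have "linear_part (h + h') = linear_part h + linear_part h'"
    by (simp add: vec_eq_iff linear_part_def distrib_right sum.distrib)
  then show "linear_part (h + h') *v w = linear_part h *v w + linear_part h' *v w"
    by (simp add: matrix_vector_mult_add_rdistrib)
  have "linear_part (r *\<^sub>R h) = r *\<^sub>R linear_part h"
    by (simp add: vec_eq_iff linear_part_def scaleR_conv_of_real[where 'a=complex] sum_distrib_left mult.assoc)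
  then show "linear_part (r *\<^sub>R h) *v w = r *\<^sub>R (linear_part h *v w)"
    by (simp add: vec_eq_iff matrix_vector_mult_def scaleR_sum_right)
qed

lemma linear_part_bound: "\<exists>\<Lambda>\<ge>0. \<forall>h w. norm (linear_part h *v w) \<le> \<Lambda> * norm h * norm w"
proof -
  have "bilinear (\<lambda>h w. linear_part h *v w)"
    unfolding bilinear_def using linear_linear_part by auto
  then have "bounded_bilinear (\<lambda>h w. linear_part h *v w)"
    by (simp add: bilinear_conv_bounded_bilinear)
  from bounded_bilinear.nonneg_bounded[OF this] show ?thesis by (auto simp: mult_ac)
qed

text \<open>The resolvent identity, obtained by applying the inverse at \<open>\<xi> + h\<close> to
  \<open>S (\<xi> + h) = S \<xi> + linear_part h\<close>.\<close>

lemma R_difference: "R (\<xi> + h) *v w - R \<xi> *v w = - (R (\<xi> + h) *v (linear_part h *v (R \<xi> *v w)))"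
proof -
  have "R (\<xi> + h) *v (S (\<xi> + h) *v (R \<xi> *v w)) = R \<xi> *v w" by (rule R_S_vec)
  then have "R (\<xi> + h) *v w + R (\<xi> + h) *v (linear_part h *v (R \<xi> *v w)) = R \<xi> *v w"
    by (simp add: S_add matrix_vector_mult_add_rdistrib matrix_vector_right_distrib S_R_vec)
  then show ?thesis by (simp add: algebra_simps)
qed

text \<open>Using the resolvent identity twice leaves an error with two factors
  \<open>linear_part h\<close>. The uniform bound on \<open>R\<close> makes it quadratic in
  \<open>h\<close>, so continuity of \<open>R\<close> need not be known beforehand.\<close>

lemma R_has_derivative:
  "((\<lambda>\<xi>. R \<xi> *v w) has_derivative (\<lambda>h. - (R \<xi> *v (linear_part h *v (R \<xi> *v w))))) (at \<xi>)"
  unfolding has_derivative_at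
proof
  let ?D = "\<lambda>h. - (R \<xi> *v (linear_part h *v (R \<xi> *v w)))"
  have "linear ?D"
    by (rule linearI)
      (simp_all add: linear_add[OF linear_linear_part] linear_cmul[OF linear_linear_part]
        matrix_vector_right_distrib linear_cmul[OF matrix_vector_mul_linear])
  then show "bounded_linear ?D" by (simp add: linear_conv_bounded_linear)
  obtain \<Lambda> where \<Lambda>: "\<Lambda> \<ge> 0" "\<And>h w. norm (linear_part h *v w) \<le> \<Lambda> * norm h * norm w"
    using linear_part_bound by blast
  \<comment> \<open>Three resolvents, each bounded by \<open>K\<close>, alternate with two copies of
    the linear part, each bounded by \<open>\<Lambda> * norm h\<close>.\<close>
  define C where "C = K * (\<Lambda> * (K * (\<Lambda> * (K * norm w))))"
  have rem: "norm (R (\<xi> + h) *v w - R \<xi> *v w - ?D h) \<le> C * (norm h)\<^sup>2" for h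
  proof -
    let ?z = "linear_part h *v (R \<xi> *v w)"
    have "R (\<xi> + h) *v w - R \<xi> *v w - ?D h = - (R (\<xi> + h) *v ?z - R \<xi> *v ?z)"
      by (simp only: R_difference[of \<xi> h w]) simp
    also have "\<dots> = R (\<xi> + h) *v (linear_part h *v (R \<xi> *v ?z))"
      by (simp only: R_difference minus_minus)
    finally have eq: "norm (R (\<xi> + h) *v w - R \<xi> *v w - ?D h) = norm (R (\<xi> + h) *v (linear_part h *v (R \<xi> *v ?z)))"
      by simp
    have "norm (R \<xi> *v w) \<le> K * norm w" by (rule R_bound)
    then have "norm ?z \<le> \<Lambda> * norm h * (K * norm w)"
      by (rule order_trans[OF \<Lambda>(2) mult_left_mono]) (use \<Lambda>(1) in simp)
    then have "norm (R \<xi> *v ?z) \<le> K * (\<Lambda> * norm h * (K * norm w))"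
      by (rule order_trans[OF R_bound mult_left_mono]) (rule K_nonneg)
    then have "norm (linear_part h *v (R \<xi> *v ?z)) \<le> \<Lambda> * norm h * (K * (\<Lambda> * norm h * (K * norm w)))"
      by (rule order_trans[OF \<Lambda>(2) mult_left_mono]) (use \<Lambda>(1) in simp)
    then have "norm (R (\<xi> + h) *v (linear_part h *v (R \<xi> *v ?z))) \<le>
        K * (\<Lambda> * norm h * (K * (\<Lambda> * norm h * (K * norm w))))"
      by (rule order_trans[OF R_bound mult_left_mono]) (rule K_nonneg)
    then show ?thesis unfolding eq C_def by (simp add: power2_eq_square mult_ac)
  qed
  show "(\<lambda>h. norm (R (\<xi> + h) *v w - R \<xi> *v w - ?D h) / norm h) \<midarrow>0\<rightarrow> 0"
  proof (rule Lim_null_comparison)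
    show "\<forall>\<^sub>F h in at 0. norm (norm (R (\<xi> + h) *v w - R \<xi> *v w - ?D h) / norm h) \<le> C * norm h"
    proof (rule eventually_at_filter[THEN iffD2], rule always_eventually, intro allI impI)
      fix h :: "real^'n" assume "h \<noteq> 0"
      then show "norm (norm (R (\<xi> + h) *v w - R \<xi> *v w - ?D h) / norm h) \<le> C * norm h"
        using rem[of h] by (simp add: divide_le_eq power2_eq_square mult_ac)
    qed
    show "(\<lambda>h::real^'n. C * norm h) \<midarrow>0\<rightarrow> 0" by (auto intro!: tendsto_eq_intros)
  qed
qed

lemma matrix_entry: "M $ i $ j = (M *v axis j 1) $ i" for M :: "complex^'m^'m"
proof -
  have "(\<Sum>k\<in>UNIV. M $ i $ k * axis j 1 $ k) = M $ i $ j"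
    by (subst sum.remove[of _ j]) (auto simp: axis_def intro!: sum.neutral)
  then show ?thesis by (simp add: matrix_vector_mult_def)
qed

lemma R_entry_has_derivative:
  "((\<lambda>\<xi>. R \<xi> $ i $ j) has_derivative (\<lambda>h. - (R \<xi> *v (linear_part h *v (R \<xi> *v axis j 1))) $ i)) (at \<xi>)"
  using bounded_linear.has_derivative[OF bounded_linear_vec_nth R_has_derivative[of "axis j 1" \<xi>], of i]
  unfolding matrix_entry[of "R _" i j] by simp

lemma pd_R_entry:
  "pd l (\<lambda>\<xi>. R \<xi> $ i $ j) = (\<lambda>\<xi>. \<Sum>k\<in>UNIV. \<Sum>k'\<in>UNIV. (- A l $ k $ k') * (R \<xi> $ i $ k * R \<xi> $ k' $ j))"
proof
  fix \<xi>
  have "pd l (\<lambda>\<xi>. R \<xi> $ i $ j) \<xi> = - (R \<xi> *v (A l *v (R \<xi> *v axis j 1))) $ i"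
    by (simp add: pd_eqI[OF R_entry_has_derivative] linear_part_axis)
  also have "\<dots> = - (\<Sum>k\<in>UNIV. R \<xi> $ i $ k * (\<Sum>k'\<in>UNIV. A l $ k $ k' * R \<xi> $ k' $ j))"
    by (subst matrix_vector_mult_def, subst matrix_vector_mult_def) (simp add: matrix_entry[of "R \<xi>" _ j])
  also have "\<dots> = (\<Sum>k\<in>UNIV. \<Sum>k'\<in>UNIV. (- A l $ k $ k') * (R \<xi> $ i $ k * R \<xi> $ k' $ j))"
    by (simp add: sum_distrib_left sum_negf[symmetric] mult.left_commute)
  finally show "pd l (\<lambda>\<xi>. R \<xi> $ i $ j) \<xi> = \<dots>" .
qed

text \<open>The algebra generated by the entries of \<open>R\<close>. It is closed under
  \<open>pd\<close> and consists of bounded functions, so rule induction yields bounds for all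
  derivatives at once.\<close>

inductive entry_algebra :: "(real^'n \<Rightarrow> complex) \<Rightarrow> bool" where
  const: "entry_algebra (\<lambda>\<xi>. c)"
| entry: "entry_algebra (\<lambda>\<xi>. R \<xi> $ i $ j)"
| add: "entry_algebra f \<Longrightarrow> entry_algebra g \<Longrightarrow> entry_algebra (\<lambda>\<xi>. f \<xi> + g \<xi>)"
| mult: "entry_algebra f \<Longrightarrow> entry_algebra g \<Longrightarrow> entry_algebra (\<lambda>\<xi>. f \<xi> * g \<xi>)"

lemma entry_algebra_sum:
  assumes "finite I" "\<And>i. i \<in> I \<Longrightarrow> entry_algebra (g i)"
  shows "entry_algebra (\<lambda>\<xi>. \<Sum>i\<in>I. g i \<xi>)"
  using assms by (induction I rule: finite_induct) (auto intro: entry_algebra.const entry_algebra.add)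

lemma entry_algebra_differentiable: "entry_algebra f \<Longrightarrow> f differentiable (at \<xi>)"
proof (induction rule: entry_algebra.induct)
  case (entry i j)
  then show ?case using R_entry_has_derivative differentiable_def by blast
qed (simp_all add: differentiable_add differentiable_mult)

lemma entry_algebra_pd: "entry_algebra f \<Longrightarrow> entry_algebra (pd l f)"
proof (induction rule: entry_algebra.induct)
  case (const c)
  then show ?case by (simp add: pd_const entry_algebra.const)
next
  case (entry i j)
  show ?case unfolding pd_R_entry
    by (intro entry_algebra_sum finite entry_algebra.mult entry_algebra.const entry_algebra.entry)
next
  case (add f g)
  then show ?case
    by (simp add: pd_add entry_algebra_differentiable entry_algebra.add)
next
  case (mult f g)
  then show ?case
    by (simp add: pd_mult entry_algebra_differentiable entry_algebra.add[OF entry_algebra.mult entry_algebra.mult])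
qed

lemma entry_algebra_bounded: "entry_algebra f \<Longrightarrow> \<exists>B. \<forall>\<xi>. norm (f \<xi>) \<le> B"
proof (induction rule: entry_algebra.induct)
  case (const c)
  then show ?case by auto
next
  case (entry i j)
  have "norm (R \<xi> $ i $ j) \<le> K" for \<xi>
    unfolding matrix_entry[of "R \<xi>" i j]
    using order_trans[OF Finite_Cartesian_Product.norm_nth_le R_bound[of \<xi> "axis j 1"]] by simp
  then show ?case by blast
next
  case (add f g)
  then obtain B C where B: "\<And>\<xi>. norm (f \<xi>) \<le> B" and C: "\<And>\<xi>. norm (g \<xi>) \<le> C" by blast
  have "norm (f \<xi> + g \<xi>) \<le> B + C" for \<xi>
    by (rule order_trans[OF norm_triangle_ineq add_mono[OF B C]])
  then show ?case by blast
next
  case (mult f g)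
  then obtain B C where B: "\<And>\<xi>. norm (f \<xi>) \<le> B" and C: "\<And>\<xi>. norm (g \<xi>) \<le> C" by blast
  have "norm (f \<xi> * g \<xi>) \<le> B * C" for \<xi>
    unfolding norm_mult by (intro mult_mono B C norm_ge_zero order_trans[OF norm_ge_zero B])
  then show ?case by blast
qed

lemma moderate_R: "moderate (\<lambda>\<xi>. R \<xi> $ i $ j)"
proof (rule moderate_coinduct[where F="Collect entry_algebra"])
  fix g assume "g \<in> Collect entry_algebra"
  then obtain B where "\<And>\<xi>. norm (g \<xi>) \<le> B" using entry_algebra_bounded by blast
  then show "\<exists>B k. \<forall>x. norm (g x) \<le> B * (1 + norm x) ^ k"
    by (intro exI[of _ B] exI[of _ 0]) simp
qed (auto intro: entry_algebra.entry entry_algebra_differentiable entry_algebra_pd)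

lemma S_mult_eq:
  "S \<xi> $ j $ k * c = A0 $ j $ k * c + (\<Sum>l\<in>UNIV. A l $ j $ k * (of_real (\<xi> $ l) * c))"
  unfolding S_eq distrib_right sum_distrib_right by (simp add: mult_ac)

lemma schwartz_S: "schwartz g \<Longrightarrow> schwartz (\<lambda>\<xi>. S \<xi> $ j $ k * g \<xi>)"
  unfolding S_mult_eq
  by (intro schwartz_add schwartz_sum finite schwartz_cmult schwartz_coordinate_mult)

text \<open>Moves the symbol from the frequency side to a differential operator. \<open>pd l\<close>
  of a transform brings down \<open>- \<i> * \<xi> $ l\<close>, and \<open>dpartial\<close> adds a
  sign; thus \<open>\<xi> $ l\<close> corresponds to \<open>- \<i>\<close> times
  \<open>dpartial l\<close>.\<close>

lemma regular_fourier_S: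
  assumes u: "u \<in> Lp (ennreal q)" "1 \<le> q" and g: "schwartz g"
  shows "regular u (fourier (\<lambda>\<xi>. S \<xi> $ j $ k * g \<xi>)) =
    A0 $ j $ k *s regular u (fourier g) +
    (\<Sum>l\<in>UNIV. (- \<i> * A l $ j $ k) *s dpartial l (regular u) (fourier g))"
proof -
  have c: "schwartz (\<lambda>\<xi>. of_real (\<xi> $ l) * g \<xi>)" for l by (rule schwartz_coordinate_mult[OF g])
  have "fourier (\<lambda>\<xi>. S \<xi> $ j $ k * g \<xi>) =
     fourier (\<lambda>\<xi>. A0 $ j $ k * g \<xi> + (\<Sum>l\<in>UNIV. A l $ j $ k * (of_real (\<xi> $ l) * g \<xi>)))"
    unfolding S_mult_eq ..
  also have "\<dots> = (\<lambda>x. A0 $ j $ k * fourier g x +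
      (\<Sum>l\<in>UNIV. A l $ j $ k * fourier (\<lambda>\<xi>. of_real (\<xi> $ l) * g \<xi>) x))"
    by (rule ext) (simp only: fourier_add schwartz_cmult schwartz_sum g c finite fourier_sum fourier_cmult)
  finally have "regular u (fourier (\<lambda>\<xi>. S \<xi> $ j $ k * g \<xi>)) = A0 $ j $ k *s regular u (fourier g) +
    (\<Sum>l\<in>UNIV. A l $ j $ k *s regular u (fourier (\<lambda>\<xi>. of_real (\<xi> $ l) * g \<xi>)))"
    by (simp only: regular_add[OF u] regular_sum[OF u] regular_cmult[OF u]
      schwartz_cmult schwartz_sum schwartz_fourier g c finite)
  moreover have "A l $ j $ k *s regular u (fourier (\<lambda>\<xi>. of_real (\<xi> $ l) * g \<xi>)) =
     (- \<i> * A l $ j $ k) *s dpartial l (regular u) (fourier g)" for l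
  proof -
    have "pd l (fourier g) = (\<lambda>x. - \<i> * fourier (\<lambda>\<xi>. of_real (\<xi> $ l) * g \<xi>) x)"
      unfolding pd_fourier[OF g] fourier_cmult ..
    then have "dpartial l (regular u) (fourier g) = - ((- \<i>) *s regular u (fourier (\<lambda>\<xi>. of_real (\<xi> $ l) * g \<xi>)))"
      unfolding dpartial_def by (simp only: regular_cmult[OF u] schwartz_fourier c)
    then show ?thesis by (simp add: vec_eq_iff algebra_simps)
  qed
  ultimately show ?thesis by simp
qed

text \<open>Unfolded, \<open>f\<close> is tested with transforms of
  \<open>R \<xi> $ i $ j * \<phi> \<xi>\<close>. These are Schwartz functions, so the equation
  replaces \<open>f\<close> by \<open>P\<close> applied to \<open>u\<close>. The operator then
  becomes the factor \<open>S\<close> next to \<open>R\<close>, and the two cancel inside the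
  transform.\<close>

lemma multiplier_graph_resolvent:
  fixes P :: "('n, 'm) distribution \<Rightarrow> ('n, 'm) distribution"
  assumes P: "\<And>T \<phi> j. P T \<phi> $ j =
      (\<Sum>k\<in>UNIV. A0 $ j $ k * T \<phi> $ k + (\<Sum>l\<in>UNIV. - \<i> * A l $ j $ k * dpartial l T \<phi> $ k))"
    and u: "u \<in> Lp (ennreal q)" "1 \<le> q"
    and f: "\<And>\<phi>. schwartz \<phi> \<Longrightarrow> regular f \<phi> = P (regular u) \<phi>"
  shows "multiplier_graph (\<lambda>\<xi>. matrix_inv (S \<xi>)) f u"
  unfolding multiplier_graph_def dist_eq_def
proof (intro allI impI)
  fix \<phi> :: "real^'n \<Rightarrow> complex" assume \<phi>: "schwartz \<phi>"
  have g: "schwartz (\<lambda>\<xi>. R \<xi> $ i $ j * \<phi> \<xi>)" for i j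
    by (rule schwartz_mult[OF moderate_R \<phi>])
  have Pg: "P (regular u) (fourier g) $ j = (\<Sum>k\<in>UNIV. regular u (fourier (\<lambda>\<xi>. S \<xi> $ j $ k * g \<xi>)) $ k)"
    if "schwartz g" for g j
    by (simp add: P regular_fourier_S[OF u that])
  have "dmult R (dfourier (regular f)) \<phi> $ i = dfourier (regular u) \<phi> $ i" for i
  proof -
    have "dmult R (dfourier (regular f)) \<phi> $ i =
        (\<Sum>j\<in>UNIV. regular f (fourier (\<lambda>\<xi>. R \<xi> $ i $ j * \<phi> \<xi>)) $ j)"
      by (simp add: dmult_def dfourier_def)
    also have "\<dots> = (\<Sum>j\<in>UNIV. \<Sum>k\<in>UNIV. regular u (fourier (\<lambda>\<xi>. S \<xi> $ j $ k * (R \<xi> $ i $ j * \<phi> \<xi>))) $ k)"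
      by (simp only: f schwartz_fourier g Pg)
    \<comment> \<open>With the sum over \<open>j\<close> innermost, linearity of the pairing and of
      the transform assembles the entry \<open>(R \<xi> ** S \<xi>) $ i $ k\<close>, which is that
      of the identity.\<close>
    also have "\<dots> = (\<Sum>k\<in>UNIV. \<Sum>j\<in>UNIV. regular u (fourier (\<lambda>\<xi>. S \<xi> $ j $ k * (R \<xi> $ i $ j * \<phi> \<xi>))) $ k)"
      by (rule sum.swap)
    also have "\<dots> = (\<Sum>k\<in>UNIV. regular u (fourier (\<lambda>\<xi>. (if i = k then 1 else 0) * \<phi> \<xi>)) $ k)"
    proof (rule sum.cong[OF refl])
      fix k
      have "(\<Sum>j\<in>UNIV. regular u (fourier (\<lambda>\<xi>. S \<xi> $ j $ k * (R \<xi> $ i $ j * \<phi> \<xi>)))) =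
         regular u (\<lambda>x. \<Sum>j\<in>UNIV. fourier (\<lambda>\<xi>. S \<xi> $ j $ k * (R \<xi> $ i $ j * \<phi> \<xi>)) x)"
        by (rule regular_sum[OF u finite, symmetric]) (intro schwartz_fourier schwartz_S g)
      also have "(\<lambda>x. \<Sum>j\<in>UNIV. fourier (\<lambda>\<xi>. S \<xi> $ j $ k * (R \<xi> $ i $ j * \<phi> \<xi>)) x) =
         fourier (\<lambda>\<xi>. \<Sum>j\<in>UNIV. S \<xi> $ j $ k * (R \<xi> $ i $ j * \<phi> \<xi>))"
        by (rule ext, rule fourier_sum[OF finite, symmetric]) (intro schwartz_S g)
      also have "(\<lambda>\<xi>. \<Sum>j\<in>UNIV. S \<xi> $ j $ k * (R \<xi> $ i $ j * \<phi> \<xi>)) = (\<lambda>\<xi>. (R \<xi> ** S \<xi>) $ i $ k * \<phi> \<xi>)"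
        by (simp only: matrix_matrix_mult_def vec_lambda_beta sum_distrib_right) (simp add: mult_ac)
      also have "\<dots> = (\<lambda>\<xi>. (if i = k then 1 else 0) * \<phi> \<xi>)"
        by (simp add: R_S mat_def)
      finally show "(\<Sum>j\<in>UNIV. regular u (fourier (\<lambda>\<xi>. S \<xi> $ j $ k * (R \<xi> $ i $ j * \<phi> \<xi>))) $ k) =
          regular u (fourier (\<lambda>\<xi>. (if i = k then 1 else 0) * \<phi> \<xi>)) $ k"
        by (simp only: sum_component[symmetric])
    qed
    also have "\<dots> = (\<Sum>k\<in>UNIV. (if i = k then 1 else 0) * regular u (fourier \<phi>) $ k)"
    proof -
      have "regular u (fourier (\<lambda>\<xi>. c * \<phi> \<xi>)) = c *s regular u (fourier \<phi>)" for c
      proof -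
        have "fourier (\<lambda>\<xi>. c * \<phi> \<xi>) = (\<lambda>x. c * fourier \<phi> x)" by (rule ext) (rule fourier_cmult)
        then show ?thesis by (simp only: regular_cmult[OF u schwartz_fourier[OF \<phi>]])
      qed
      then show ?thesis by simp
    qed
    also have "\<dots> = regular u (fourier \<phi>) $ i"
      by (subst sum.remove[of _ i]) (auto intro!: sum.neutral)
    finally show ?thesis by (simp add: dfourier_def)
  qed
  then show "dfourier (regular u) \<phi> = dmult (\<lambda>\<xi>. matrix_inv (S \<xi>)) (dfourier (regular f)) \<phi>"
    unfolding R_def[symmetric] by (simp add: vec_eq_iff)
qed

end

section \<open>Hoelder's inequality and the eigenvalue equation\<close>

text \<open>Young's inequality applied to \<open>F\<close> and \<open>G\<close> after normalizing
  both to have integral 1 in their powers.\<close>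

lemma Holder_inequality:
  fixes F G :: "'a \<Rightarrow> real"
  assumes st: "1 < s" "1 < t" "1 / s + 1 / t = 1"
    and meas: "F \<in> borel_measurable M" "G \<in> borel_measurable M"
    and nonneg: "\<And>x. 0 \<le> F x" "\<And>x. 0 \<le> G x"
    and int: "integrable M (\<lambda>x. F x powr s)" "integrable M (\<lambda>x. G x powr t)"
  shows "integrable M (\<lambda>x. F x * G x)"
    and "(LINT x|M. F x * G x) \<le> (LINT x|M. F x powr s) powr (1 / s) * (LINT x|M. G x powr t) powr (1 / t)"
proof -
  define a where "a = (LINT x|M. F x powr s)"
  define b where "b = (LINT x|M. G x powr t)"
  show FG: "integrable M (\<lambda>x. F x * G x)"
  proof (rule Bochner_Integration.integrable_bound)
    show "integrable M (\<lambda>x. F x powr s / s + G x powr t / t)"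
      by (intro Bochner_Integration.integrable_add integrable_divide int)
    show "AE x in M. norm (F x * G x) \<le> norm (F x powr s / s + G x powr t / t)"
      using Youngs_inequality[OF st nonneg] nonneg st by (auto simp: abs_of_nonneg)
  qed (intro borel_measurable_times meas)
  have "(LINT x|M. F x * G x) \<le> a powr (1 / s) * b powr (1 / t)"
  \<comment> \<open>Normalization divides by \<open>\<alpha>\<close> and \<open>\<beta>\<close>. If
    one of the integrals is 0, the product vanishes almost everywhere instead.\<close>
  proof (cases "a = 0 \<or> b = 0")
    case True
    then have "(AE x in M. F x powr s = 0) \<or> (AE x in M. G x powr t = 0)"
      unfolding a_def b_def by (subst (asm) (1 2) integral_nonneg_eq_0_iff_AE) (use int in auto)
    then have "AE x in M. F x * G x = 0" by auto
    then have "(LINT x|M. F x * G x) = 0" by (simp add: integral_eq_zero_AE)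
    then show ?thesis by simp
  next
    case False
    have "0 \<le> a" "0 \<le> b" unfolding a_def b_def by (simp_all add: integral_nonneg)
    with False have ab: "0 < a" "0 < b" by auto
    define \<alpha> where "\<alpha> = a powr (1 / s)"
    define \<beta> where "\<beta> = b powr (1 / t)"
    have \<alpha>: "0 < \<alpha>" "\<alpha> powr s = a" and \<beta>: "0 < \<beta>" "\<beta> powr t = b"
      using ab st by (auto simp: \<alpha>_def \<beta>_def powr_powr)
    have pt: "F x * G x \<le> \<alpha> * \<beta> * (F x powr s / (a * s) + G x powr t / (b * t))" for x
    proof -
      have "(F x / \<alpha>) * (G x / \<beta>) \<le> (F x / \<alpha>) powr s / s + (G x / \<beta>) powr t / t"
        using \<alpha> \<beta> nonneg by (intro Youngs_inequality[OF st]) auto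
      also have "\<dots> = F x powr s / (a * s) + G x powr t / (b * t)"
        using \<alpha> \<beta> nonneg by (simp add: powr_divide)
      finally have "\<alpha> * \<beta> * ((F x / \<alpha>) * (G x / \<beta>)) \<le> \<alpha> * \<beta> * (F x powr s / (a * s) + G x powr t / (b * t))"
        using \<alpha>(1) \<beta>(1) by (intro mult_left_mono) auto
      then show ?thesis using \<alpha>(1) \<beta>(1) by simp
    qed
    have "(LINT x|M. F x * G x) \<le> (LINT x|M. \<alpha> * \<beta> * (F x powr s / (a * s) + G x powr t / (b * t)))"
      by (intro Bochner_Integration.integral_mono FG integrable_mult_right
          Bochner_Integration.integrable_add integrable_divide int pt)
    also have "\<dots> = \<alpha> * \<beta> * (a / (a * s) + b / (b * t))"
      using int by (simp add: a_def b_def)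
    also have "\<dots> = \<alpha> * \<beta>"
      using ab st by simp
    finally show ?thesis by (simp add: \<alpha>_def \<beta>_def)
  qed
  then show "(LINT x|M. F x * G x) \<le> (LINT x|M. F x powr s) powr (1 / s) * (LINT x|M. G x powr t) powr (1 / t)"
    by (simp add: a_def b_def)
qed

lemma Lp_norm_eq_integral:
  assumes "0 < p" "integrable lebesgue (\<lambda>x. norm (f x) powr p)"
  shows "Lp_norm (ennreal p) f = ennreal ((LINT x|lebesgue. norm (f x) powr p) powr (1 / p))"
  using assms
  by (simp add: Lp_norm_def Let_def nn_integral_eq_integral integral_nonneg)

lemma Lp_norm_finite_integrable:
  assumes "0 < p" "(\<lambda>x. norm (f x)) \<in> borel_measurable lebesgue" "Lp_norm (ennreal p) f < \<infinity>"
  shows "integrable lebesgue (\<lambda>x. norm (f x) powr p)"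
proof -
  have "(\<integral>\<^sup>+x. ennreal (norm (f x) powr p) \<partial>lebesgue) < \<infinity>"
    using assms(1,3) by (auto simp: Lp_norm_def Let_def less_top split: if_splits)
  then show ?thesis using assms(2) by (auto simp: integrable_iff_bounded)
qed

text \<open>Supplies measurability of the pointwise operator norm of a potential. The triangle
  inequality, used with both orders of the two matrices, makes the operator norm Lipschitz.\<close>

lemma continuous_onorm_matrix: "continuous_on UNIV (\<lambda>M :: complex^'m^'m. onorm ((*v) M))"
proof -
  have "bilinear ((*v) :: complex^'m^'m \<Rightarrow> complex^'m \<Rightarrow> complex^'m)"
    unfolding bilinear_def
    by (auto intro!: linearI simp: matrix_vector_mult_add_rdistrib)
      (simp add: vec_eq_iff matrix_vector_mult_def scaleR_sum_right)
  then have "bounded_bilinear ((*v) :: complex^'m^'m \<Rightarrow> complex^'m \<Rightarrow> complex^'m)"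
    by (simp add: bilinear_conv_bounded_bilinear)
  then obtain C where C: "C \<ge> 0" "\<And>(M :: complex^'m^'m) v. norm (M *v v) \<le> norm M * norm v * C"
    using bounded_bilinear.nonneg_bounded by blast
  have le: "onorm ((*v) M) \<le> onorm ((*v) N) + C * norm (M - N)" for M N :: "complex^'m^'m"
  proof (rule onorm_bound)
    have nn: "0 \<le> onorm ((*v) N)" by (rule onorm_pos_le) (rule matrix_vector_mul_bounded_linear)
    then show "0 \<le> onorm ((*v) N) + C * norm (M - N)" using C(1) by simp
    fix v
    have "norm (M *v v) = norm (N *v v + (M - N) *v v)" by (simp add: matrix_vector_mult_diff_rdistrib)
    also have "\<dots> \<le> norm (N *v v) + norm ((M - N) *v v)" by (rule norm_triangle_ineq)
    also have "\<dots> \<le> onorm ((*v) N) * norm v + norm (M - N) * norm v * C"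
      by (intro add_mono C(2) onorm matrix_vector_mul_bounded_linear)
    finally show "norm (M *v v) \<le> (onorm ((*v) N) + C * norm (M - N)) * norm v"
      by (simp add: algebra_simps)
  qed
  have "C-lipschitz_on UNIV (\<lambda>M :: complex^'m^'m. onorm ((*v) M))"
  proof (rule lipschitz_onI)
    fix M N :: "complex^'m^'m"
    show "dist (onorm ((*v) M)) (onorm ((*v) N)) \<le> C * dist M N"
      using le[of M N] le[of N M] by (simp add: dist_norm norm_minus_commute abs_le_iff)
  qed (rule C)
  then show ?thesis by (rule lipschitz_on_continuous_on)
qed

lemma borel_measurable_matrix_vector:
  fixes V :: "'a \<Rightarrow> complex^'m^'m"
  assumes "V \<in> borel_measurable M" "u \<in> borel_measurable M"
  shows "(\<lambda>x. V x *v u x) \<in> borel_measurable M"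
  unfolding matrix_vector_mult_def
  by (rule borel_measurable_continuous_Pair[OF assms]) (intro continuous_intros)

text \<open>With \<open>r = p * q / (q - p)\<close> one has \<open>1 / p = 1 / r + 1 / q\<close>:
  multiplication by \<open>V\<close> leads from exponent \<open>q\<close> back to \<open>p\<close>,
  opposite to the resolvent.\<close>

lemma Lp_matrix_vector:
  fixes V :: "real^'n \<Rightarrow> complex^'m^'m"
  assumes p: "1 < p" "p \<le> q"
    and V: "V \<in> borel_measurable lebesgue" "potential_norm (potential_exponent p q) V < \<infinity>"
    and u: "u \<in> Lp (ennreal q)"
  shows "(\<lambda>x. V x *v u x) \<in> Lp (ennreal p)"
    and "Lp_norm (ennreal p) (\<lambda>x. V x *v u x) \<le> potential_norm (potential_exponent p q) V * Lp_norm (ennreal q) u"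
proof -
  let ?v = "\<lambda>x. onorm ((*v) (V x))"
  let ?N = "potential_norm (potential_exponent p q) V"
  have q: "1 < q" using p by simp
  have um: "u \<in> borel_measurable lebesgue" and uf: "Lp_norm (ennreal q) u < \<infinity>"
    using u by (auto simp: Lp_def)
  have uq: "integrable lebesgue (\<lambda>x. norm (u x) powr q)"
    using q um uf by (intro Lp_norm_finite_integrable) auto
  have vm: "?v \<in> borel_measurable lebesgue"
    by (rule measurable_compose[OF V(1) borel_measurable_continuous_onI[OF continuous_onorm_matrix]])
  have v0: "0 \<le> ?v x" for x by (rule onorm_pos_le) (rule matrix_vector_mul_bounded_linear)
  have Vum: "(\<lambda>x. V x *v u x) \<in> borel_measurable lebesgue"
    by (rule borel_measurable_matrix_vector[OF V(1) um])
  have pt: "norm (V x *v u x) powr p \<le> (?v x * norm (u x)) powr p" for x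
    using p by (intro powr_mono2 onorm matrix_vector_mul_bounded_linear) auto
  have "Lp_norm (ennreal p) (\<lambda>x. V x *v u x) \<le> ?N * Lp_norm (ennreal q) u"
  proof (cases "p = q")
    \<comment> \<open>The exponent of the potential is infinite here, and its norm is an essential
      supremum.\<close>
    case True
    have N: "?N = esssup lebesgue (\<lambda>x. ennreal (?v x))"
      using True v0 by (simp add: potential_norm_def potential_exponent_def Lp_norm_def)
    obtain c where c: "?N = ennreal c" "0 \<le> c"
      using V(2) by (cases ?N) auto
    have AE: "AE x in lebesgue. ?v x \<le> c"
      using esssup_AE[of "\<lambda>x. ennreal (?v x)" lebesgue] c unfolding N
      by (auto simp: ennreal_le_iff)
    have AE': "AE x in lebesgue. norm (V x *v u x) powr p \<le> c powr p * norm (u x) powr p"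
      using AE
    proof (rule AE_mp, intro AE_I2 impI)
      fix x assume "?v x \<le> c"
      then have "(?v x * norm (u x)) powr p \<le> (c * norm (u x)) powr p"
        using p v0[of x] by (intro powr_mono2 mult_right_mono) auto
      then show "norm (V x *v u x) powr p \<le> c powr p * norm (u x) powr p"
        using pt[of x] c(2) by (simp add: powr_mult)
    qed
    have up: "integrable lebesgue (\<lambda>x. c powr p * norm (u x) powr p)"
      using uq True by simp
    have Vup: "integrable lebesgue (\<lambda>x. norm (V x *v u x) powr p)"
      by (rule Bochner_Integration.integrable_bound[OF up]) (use Vum AE' in auto)
    have "(LINT x|lebesgue. norm (V x *v u x) powr p) \<le> (LINT x|lebesgue. c powr p * norm (u x) powr p)"
      by (rule integral_mono_AE[OF Vup up AE'])
    then have "(LINT x|lebesgue. norm (V x *v u x) powr p) powr (1 / p) \<le>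
        (c powr p * (LINT x|lebesgue. norm (u x) powr p)) powr (1 / p)"
      using p by (intro powr_mono2) (auto simp: integral_nonneg)
    also have "\<dots> = c * (LINT x|lebesgue. norm (u x) powr q) powr (1 / q)"
      using p c(2) True by (simp add: powr_mult powr_powr integral_nonneg)
    finally show ?thesis
      unfolding c(1) using p q c(2) uq Vup
      by (simp add: Lp_norm_eq_integral ennreal_mult[symmetric] ennreal_leI)
  next
    case False
    then have pq: "p < q" using p by simp
    \<comment> \<open>Hoelder's inequality is applied to the \<open>p\<close>-th powers, with the
      conjugate exponents \<open>r / p\<close> and \<open>q / p\<close>.\<close>
    define r where "r = p * q / (q - p)"
    have rp: "r / p = q / (q - p)" using p by (simp add: r_def)
    have r: "0 < r" "1 < r / p" "1 < q / p" "1 / (r / p) + 1 / (q / p) = 1"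
      unfolding rp using p pq by (simp_all add: r_def diff_divide_distrib)
    have N: "?N = Lp_norm (ennreal r) ?v"
      using pq by (simp add: potential_norm_def potential_exponent_def r_def)
    have vr: "integrable lebesgue (\<lambda>x. norm (?v x) powr r)"
      by (rule Lp_norm_finite_integrable[OF r(1) _ V(2)[unfolded N]]) (use vm in simp)
    define F where "F = (\<lambda>x. ?v x powr p)"
    define G where "G = (\<lambda>x. norm (u x) powr p)"
    have Fs: "F x powr (r / p) = norm (?v x) powr r" and Gs: "G x powr (q / p) = norm (u x) powr q" for x
      using p v0[of x] by (auto simp: F_def G_def powr_powr)
    have Fm: "F \<in> borel_measurable lebesgue" and Gm: "G \<in> borel_measurable lebesgue"
      using vm um by (auto simp: F_def G_def)
    have F0: "0 \<le> F x" and G0: "0 \<le> G x" for x by (simp_all add: F_def G_def)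
    have Fi: "integrable lebesgue (\<lambda>x. F x powr (r / p))" and Gi: "integrable lebesgue (\<lambda>x. G x powr (q / p))"
      unfolding Fs Gs by (rule vr uq)+
    note Holder = Holder_inequality[OF r(2-4) Fm Gm F0 G0 Fi Gi]
    have FG: "integrable lebesgue (\<lambda>x. F x * G x)" by (rule Holder)
    have H: "(LINT x|lebesgue. F x * G x) \<le> (LINT x|lebesgue. norm (?v x) powr r) powr (1 / (r / p)) *
        (LINT x|lebesgue. norm (u x) powr q) powr (1 / (q / p))"
      using Holder(2) unfolding Fs Gs .
    have pt': "norm (V x *v u x) powr p \<le> F x * G x" for x
      using pt[of x] v0[of x] by (simp add: F_def G_def powr_mult)
    have Vup: "integrable lebesgue (\<lambda>x. norm (V x *v u x) powr p)"
      by (rule Bochner_Integration.integrable_bound[OF FG])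
        (use Vum pt' in \<open>auto intro!: AE_I2 order_trans[OF _ abs_ge_self]\<close>)
    have "(LINT x|lebesgue. norm (V x *v u x) powr p) \<le> (LINT x|lebesgue. F x * G x)"
      by (rule Bochner_Integration.integral_mono[OF Vup FG pt'])
    then have "(LINT x|lebesgue. norm (V x *v u x) powr p) powr (1 / p) \<le>
       ((LINT x|lebesgue. norm (?v x) powr r) powr (1 / (r / p)) *
        (LINT x|lebesgue. norm (u x) powr q) powr (1 / (q / p))) powr (1 / p)"
      using p H by (intro powr_mono2) (auto simp: integral_nonneg)
    also have "\<dots> = (LINT x|lebesgue. norm (?v x) powr r) powr (1 / r) *
        (LINT x|lebesgue. norm (u x) powr q) powr (1 / q)"
      using p by (simp add: powr_mult powr_powr)
    finally show ?thesis
      unfolding N using p q r(1) uq vr Vup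
      by (simp add: Lp_norm_eq_integral ennreal_mult[symmetric] ennreal_leI)
  qed
  then show "Lp_norm (ennreal p) (\<lambda>x. V x *v u x) \<le> ?N * Lp_norm (ennreal q) u" .
  also have "\<dots> < \<infinity>" using V(2) uf by (simp add: ennreal_mult_less_top)
  finally show "(\<lambda>x. V x *v u x) \<in> Lp (ennreal p)" using Vum by (simp add: Lp_def)
qed

section \<open>From the eigenvalue equation to a vanishing function\<close>

lemma Lp_norm_uminus: "Lp_norm p (\<lambda>x. - f x) = Lp_norm p f"
  by (simp add: Lp_norm_def)

lemma Lp_norm_zero_AE:
  assumes "0 < q" "u \<in> Lp (ennreal q)" "Lp_norm (ennreal q) u = 0"
  shows "AE x in lebesgue. u x = 0"
proof -
  have uq: "integrable lebesgue (\<lambda>x. norm (u x) powr q)"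
    using assms by (intro Lp_norm_finite_integrable) (auto simp: Lp_def)
  have "(LINT x|lebesgue. norm (u x) powr q) = 0"
    using assms by (simp add: Lp_norm_eq_integral uq ennreal_eq_0_iff powr_eq_0_iff integral_nonneg)
  then have "AE x in lebesgue. norm (u x) powr q = 0"
    by (subst (asm) integral_nonneg_eq_0_iff_AE) (use uq in auto)
  then show ?thesis by auto
qed

text \<open>A strict bound on an infimum exhibits an admissible constant below it; the infimum
  itself may fail to be admissible.\<close>

lemma multiplier_norm_bound:
  assumes "multiplier_norm p X q Y a < ennreal B" "f \<in> X" "g \<in> Y" "multiplier_graph a f g"
  obtains K where "0 \<le> K" "K < B" "Lp_norm q g \<le> ennreal K * Lp_norm p f"
proof -
  obtain K where K: "0 \<le> K" "ennreal K < ennreal B"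
    and *: "\<forall>f\<in>X. (\<exists>g\<in>Y. multiplier_graph a f g) \<and>
              (\<forall>g\<in>Y. multiplier_graph a f g \<longrightarrow> Lp_norm q g \<le> ennreal K * Lp_norm p f)"
    using assms(1) unfolding multiplier_norm_def Inf_less_iff by blast
  have "Lp_norm q g \<le> ennreal K * Lp_norm p f" using * assms(2-4) by blast
  then show thesis using K by (intro that[of K]) (simp_all add: ennreal_less_iff)
qed

text \<open>Here \<open>B\<close> bounds the resolvent at the one frequency built into
  \<open>S\<close>. The spaces \<open>X\<close> and \<open>Y\<close> stay abstract; the assumption
  on \<open>X\<close> is where an instance transfers the divergence condition from \<open>u\<close>
  to \<open>- V u\<close>.\<close>

lemma (in affine_symbol) eigenfunction_zero:
  fixes P :: "('n, 'm) distribution \<Rightarrow> ('n, 'm) distribution" and V :: "real^'n \<Rightarrow> complex^'m^'m"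
  assumes P: "\<And>T \<phi> j. P T \<phi> $ j =
      (\<Sum>k\<in>UNIV. A0 $ j $ k * T \<phi> $ k + (\<Sum>l\<in>UNIV. - \<i> * A l $ j $ k * dpartial l T \<phi> $ k))"
    and p: "1 < p" "p \<le> q" and C: "0 < B" "0 < t" "t < 1"
    and bound: "multiplier_norm (ennreal p) X (ennreal q) Y (\<lambda>\<xi>. matrix_inv (S \<xi>)) \<le> ennreal B"
    and V: "V \<in> borel_measurable lebesgue" "potential_norm (potential_exponent p q) V \<le> ennreal (t * inverse B)"
    and Y: "Y \<subseteq> Lp (ennreal q)" and u: "u \<in> Y"
    and X: "\<And>f. f \<in> Lp (ennreal p) \<Longrightarrow> (\<And>\<phi>. schwartz \<phi> \<Longrightarrow> regular f \<phi> = P (regular u) \<phi>) \<Longrightarrow> f \<in> X"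
    and eq: "dist_eq (\<lambda>\<phi>. P (regular u) \<phi> + regular (\<lambda>x. V x *v u x) \<phi>) (\<lambda>_. 0)"
  shows "AE x in lebesgue. u x = 0"
proof -
  have uq: "u \<in> Lp (ennreal q)" using Y u by blast
  have q: "1 \<le> q" "0 < q" using p by auto
  define N where "N = Lp_norm (ennreal q) u"
  have Vfin: "potential_norm (potential_exponent p q) V < \<infinity>"
    using V(2) by (rule le_less_trans) simp
  define f where "f = (\<lambda>x. - (V x *v u x))"
  have "f \<in> Lp (ennreal p)"
    using Lp_matrix_vector(1)[OF p V(1) Vfin uq] by (simp add: f_def Lp_def Lp_norm_uminus)
  moreover have f: "regular f \<phi> = P (regular u) \<phi>" if "schwartz \<phi>" for \<phi>
  proof -
    have "regular f \<phi> = - regular (\<lambda>x. V x *v u x) \<phi>"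
      by (simp add: regular_def f_def)
    moreover have "P (regular u) \<phi> = - regular (\<lambda>x. V x *v u x) \<phi>"
      using eq that by (simp add: dist_eq_def add_eq_0_iff2)
    ultimately show ?thesis by simp
  qed
  ultimately have fX: "f \<in> X" by (rule X)
  have graph: "multiplier_graph (\<lambda>\<xi>. matrix_inv (S \<xi>)) f u"
    by (rule multiplier_graph_resolvent[OF P uq q(1) f])
  \<comment> \<open>Since \<open>t < 1\<close>, the bound becomes strict, and the constant
    \<open>k < B / t\<close> obtained from it still gives \<open>k * t / B < 1\<close>.\<close>
  have "B < B / t" using C by (simp add: field_simps)
  then have "multiplier_norm (ennreal p) X (ennreal q) Y (\<lambda>\<xi>. matrix_inv (S \<xi>)) < ennreal (B / t)"
    using C by (intro le_less_trans[OF bound]) (simp add: ennreal_less_iff)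
  then obtain k where k: "0 \<le> k" "k < B / t" "N \<le> ennreal k * Lp_norm (ennreal p) f"
    unfolding N_def by (rule multiplier_norm_bound[OF _ fX u graph])
  have "Lp_norm (ennreal p) f \<le> ennreal (t * inverse B) * N"
    unfolding f_def Lp_norm_uminus N_def
    by (rule order_trans[OF Lp_matrix_vector(2)[OF p V(1) Vfin uq] mult_right_mono[OF V(2)]]) simp
  then have "N \<le> ennreal k * (ennreal (t * inverse B) * N)"
    by (rule order_trans[OF k(3) mult_left_mono]) simp
  \<comment> \<open>Cancelling the norm of \<open>u\<close> requires it to be finite, so the
    inequality is transferred to the reals.\<close>
  moreover obtain n where n: "N = ennreal n" "0 \<le> n"
    using uq by (cases N) (auto simp: N_def Lp_def)
  moreover have "ennreal k * (ennreal (t * inverse B) * ennreal n) = ennreal (k * (t * inverse B) * n)"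
    using k(1) C n(2) by (simp add: ennreal_mult mult.assoc)
  ultimately have "n \<le> k * (t * inverse B) * n"
    using k(1) C n(2) by (simp add: ennreal_le_iff)
  moreover have "k * (t * inverse B) < 1"
    using k(2) C by (simp add: field_simps)
  ultimately have "n = 0"
    using n(2) mult_strict_right_mono[of "k * (t * inverse B)" 1 n] by fastforce
  then show ?thesis
    using Lp_norm_zero_AE[OF q(2) uq] n by (simp add: N_def)
qed

section \<open>Symmetrizable systems\<close>

text \<open>The quadratic form attains a positive minimum on the compact unit sphere; homogeneity
  extends the bound to all vectors.\<close>

lemma pos_def_lower_bound:
  fixes W :: "real^'m^'m"
  assumes "pos_def W"
  obtains c where "0 < c" "\<And>v. c * (norm v)\<^sup>2 \<le> v \<bullet> (W *v v)"
proof -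
  have "\<exists>x\<in>sphere (0 :: real^'m) 1. \<forall>y\<in>sphere 0 1. x \<bullet> (W *v x) \<le> y \<bullet> (W *v y)"
  proof (rule continuous_attains_inf)
    have "axis undefined 1 \<in> sphere (0 :: real^'m) 1" by simp
    then show "sphere (0 :: real^'m) 1 \<noteq> {}" by blast
    show "continuous_on (sphere 0 1) (\<lambda>x. x \<bullet> (W *v x))"
      by (intro continuous_on_inner continuous_on_id linear_continuous_on matrix_vector_mul_bounded_linear)
  qed simp
  then obtain x where x: "norm x = 1" "\<And>y. norm y = 1 \<Longrightarrow> x \<bullet> (W *v x) \<le> y \<bullet> (W *v y)"
    by auto
  show thesis
  proof
    show "0 < x \<bullet> (W *v x)" using assms x(1) unfolding pos_def_def by (metis norm_zero zero_neq_one)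
    fix v :: "real^'m"
    show "(x \<bullet> (W *v x)) * (norm v)\<^sup>2 \<le> v \<bullet> (W *v v)"
    proof (cases "v = 0")
      case False
      let ?y = "v /\<^sub>R norm v"
      have "x \<bullet> (W *v x) \<le> ?y \<bullet> (W *v ?y)" using False by (intro x(2)) simp
      also have "\<dots> = (v \<bullet> (W *v v)) / (norm v)\<^sup>2"
        by (simp add: matrix_vector_mult_scaleR power2_eq_square divide_inverse mult_ac)
      finally show ?thesis using False by (simp add: pos_le_divide_eq)
    qed simp
  qed
qed

text \<open>The symmetrizers contain the inverse permittivity. With
  \<open>y = matrix_inv W *v x\<close>, its quadratic form at \<open>x\<close> is that of
  \<open>W\<close> at \<open>y\<close>.\<close>

lemma pos_def_matrix_inv:
  fixes W :: "real^'m^'m"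
  assumes "pos_def W"
  shows "pos_def (matrix_inv W)"
proof -
  let ?E = "matrix_inv W"
  have sym: "transpose W = W" and pos: "\<And>x. x \<noteq> 0 \<Longrightarrow> 0 < x \<bullet> (W *v x)"
    using assms by (auto simp: pos_def_def)
  have "inj ((*v) W)"
  proof (rule injI)
    fix v w assume "W *v v = W *v w"
    then have "W *v (v - w) = 0" by (simp add: matrix_vector_mult_diff_distrib)
    then have "\<not> 0 < (v - w) \<bullet> (W *v (v - w))" by simp
    with pos[of "v - w"] show "v = w" by auto
  qed
  then have "invertible W" by (simp add: invertible_left_inverse matrix_left_invertible_injective)
  note inv = matrix_inv_inverse[OF this]
  have "transpose ?E ** W = mat 1"
    using arg_cong[OF inv(1), of transpose] by (simp add: matrix_transpose_mul sym transpose_mat)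
  then have "transpose ?E = ?E"
    by (metis inv(1) matrix_mul_assoc matrix_mul_lid matrix_mul_rid)
  moreover have "0 < x \<bullet> (?E *v x)" if "x \<noteq> 0" for x
  proof -
    have x: "W *v (?E *v x) = x" by (simp add: matrix_vector_mul_assoc inv)
    then have "?E *v x \<noteq> 0" using that by auto
    from pos[OF this] show ?thesis by (simp add: x inner_commute)
  qed
  ultimately show ?thesis by (simp add: pos_def_def)
qed

lemma complex_mat_mult: "complex_mat (A ** B) = complex_mat A ** complex_mat B"
  by (simp add: complex_mat_def vec_eq_iff matrix_matrix_mult_def)

text \<open>On complex vectors the inner product is the real part of the Hermitian one, so a real
  matrix acts separately on real and imaginary parts.\<close>

lemma inner_complex_mat:
  "v \<bullet> (complex_mat B *v w) =
    (\<Sum>i\<in>UNIV. \<Sum>j\<in>UNIV. B $ i $ j * (Re (v $ i) * Re (w $ j) + Im (v $ i) * Im (w $ j)))"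
  by (simp add: inner_vec_def matrix_vector_mult_def complex_mat_def inner_complex_def sum_distrib_left
    sum.distrib[symmetric] algebra_simps)

text \<open>The Hermitian form of a real symmetric matrix has real values; the factor
  \<open>\<i>\<close> makes them purely imaginary, and the inner product takes the real
  part.\<close>

lemma inner_symmetric_imaginary:
  assumes "transpose B = B"
  shows "v \<bullet> (complex_mat B *v (\<i> *s v)) = 0"
proof -
  have B: "B $ i $ j = B $ j $ i" for i j
    using assms by (metis transpose_def vec_lambda_beta)
  have "v \<bullet> (complex_mat B *v (\<i> *s v)) =
      (\<Sum>i\<in>UNIV. \<Sum>j\<in>UNIV. B $ i $ j * (Im (v $ i) * Re (v $ j))) -
      (\<Sum>i\<in>UNIV. \<Sum>j\<in>UNIV. B $ i $ j * (Re (v $ i) * Im (v $ j)))"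
    by (simp add: inner_complex_mat sum_subtractf[symmetric] algebra_simps)
  also have "(\<Sum>i\<in>UNIV. \<Sum>j\<in>UNIV. B $ i $ j * (Re (v $ i) * Im (v $ j))) =
      (\<Sum>j\<in>UNIV. \<Sum>i\<in>UNIV. B $ i $ j * (Re (v $ i) * Im (v $ j)))"
    by (rule sum.swap)
  also have "\<dots> = (\<Sum>i\<in>UNIV. \<Sum>j\<in>UNIV. B $ i $ j * (Im (v $ i) * Re (v $ j)))"
    by (intro sum.cong refl) (subst B, simp add: mult_ac)
  finally show ?thesis by simp
qed

lemma inner_pos_def_lower:
  fixes W :: "real^'m^'m" and v :: "complex^'m"
  assumes "\<And>v. c * (norm v)\<^sup>2 \<le> v \<bullet> (W *v v)"
  shows "c * (norm v)\<^sup>2 \<le> v \<bullet> (complex_mat W *v v)"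
proof -
  define a :: "real^'m" where "a = (\<chi> i. Re (v $ i))"
  define b :: "real^'m" where "b = (\<chi> i. Im (v $ i))"
  have "v \<bullet> (complex_mat W *v v) = a \<bullet> (W *v a) + b \<bullet> (W *v b)"
    unfolding inner_complex_mat
    by (simp add: a_def b_def inner_vec_def matrix_vector_mult_def sum_distrib_left sum.distrib[symmetric] algebra_simps)
  moreover have "(norm v)\<^sup>2 = (norm a)\<^sup>2 + (norm b)\<^sup>2"
    unfolding power2_norm_eq_inner
    by (simp add: a_def b_def inner_vec_def inner_complex_def sum.distrib)
  ultimately show ?thesis using assms[of a] assms[of b] by (simp add: distrib_left)
qed

text \<open>Pairing \<open>S \<xi> v\<close> with \<open>W v\<close> removes the first-order part, because \<open>W\<close> symmetrizes it; what is
  left is \<open>- Im \<omega>\<close> times the positive definite form of \<open>W\<close>, independently of \<open>\<xi>\<close>.\<close>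

lemma symmetrizable_affine_symbol:
  fixes W :: "real^'m^'m" and N :: "'n::finite \<Rightarrow> real^'m^'m"
  assumes W: "pos_def W" and N: "\<And>l. transpose (W ** N l) = W ** N l" and \<omega>: "\<omega> \<notin> \<real>"
    and S: "\<And>\<xi> j k. S \<xi> $ j $ k = (if j = k then \<i> * \<omega> else 0) +
      (\<Sum>l\<in>UNIV. of_real (\<xi> $ l) * (\<i> * of_real (N l $ j $ k)))"
  shows "\<exists>K. affine_symbol S (mat (\<i> * \<omega>)) (\<lambda>l. \<chi> j k. \<i> * of_real (N l $ j $ k)) K"
proof -
  obtain c where c: "0 < c" "\<And>v. c * (norm v)\<^sup>2 \<le> v \<bullet> (W *v v)" using pos_def_lower_bound[OF W] by blast
  have Im: "Im \<omega> \<noteq> 0" using \<omega> by (simp add: complex_is_Real_iff)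
  define L where "L = onorm ((*v) (complex_mat W))"
  \<comment> \<open>Combines the lower bound \<open>c\<close> for the form of \<open>W\<close> with
    Cauchy-Schwarz, where \<open>L\<close> estimates the norm of \<open>W\<close> applied to
    \<open>S \<xi> *v v\<close>.\<close>
  define K where "K = L / (c * \<bar>Im \<omega>\<bar>)"
  have "norm v \<le> K * norm (S \<xi> *v v)" for \<xi> v
  proof (cases "v = 0")
    case True
    have "0 \<le> L" unfolding L_def by (rule onorm_pos_le) (rule matrix_vector_mul_bounded_linear)
    with True c(1) show ?thesis by (simp add: K_def)
  next
    case False
    define M :: "real^'m^'m" where "M = (\<Sum>l\<in>UNIV. (\<xi> $ l) *\<^sub>R N l)"
    have "transpose (W ** M) = W ** M"
    proof -
      have "W ** M = (\<Sum>l\<in>UNIV. (\<xi> $ l) *\<^sub>R (W ** N l))"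
      proof -
        have "(\<Sum>k\<in>UNIV. W $ i $ k * (\<Sum>l\<in>UNIV. \<xi> $ l * N l $ k $ j)) =
            (\<Sum>l\<in>UNIV. \<xi> $ l * (\<Sum>k\<in>UNIV. W $ i $ k * N l $ k $ j))" for i j
          unfolding sum_distrib_left by (subst sum.swap) (simp only: mult.left_commute)
        then show ?thesis by (simp add: vec_eq_iff matrix_matrix_mult_def M_def)
      qed
      moreover have "transpose (\<Sum>l\<in>UNIV. (\<xi> $ l) *\<^sub>R (W ** N l)) = (\<Sum>l\<in>UNIV. (\<xi> $ l) *\<^sub>R transpose (W ** N l))"
        by (simp add: vec_eq_iff transpose_def)
      ultimately show ?thesis by (simp add: N)
    qed
    note zeroM = inner_symmetric_imaginary[OF this]
    have zeroW: "v \<bullet> (complex_mat W *v (\<i> *s v)) = 0" for v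
      using W by (intro inner_symmetric_imaginary) (simp add: pos_def_def)
    \<comment> \<open>Splits off the term that survives the pairing: both terms containing
      \<open>\<i> *s v\<close> are removed by \<open>zeroW\<close> and \<open>zeroM\<close>.\<close>
    have Sv: "S \<xi> *v v = - (Im \<omega> *\<^sub>R v) + Re \<omega> *\<^sub>R (\<i> *s v) + complex_mat M *v (\<i> *s v)"
    proof -
      have "S \<xi> = mat (\<i> * \<omega>) + (\<chi> j k. complex_mat M $ j $ k * \<i>)"
        by (simp add: vec_eq_iff S mat_def complex_mat_def M_def sum_distrib_right mult.assoc mult.commute[of \<i>])
      then have "S \<xi> *v v = mat (\<i> * \<omega>) *v v + (\<chi> j k. complex_mat M $ j $ k * \<i>) *v v"
        by (simp add: matrix_vector_mult_add_rdistrib)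
      also have "mat (\<i> * \<omega>) *v v = - (Im \<omega> *\<^sub>R v) + Re \<omega> *\<^sub>R (\<i> *s v)"
      proof -
        have "mat (\<i> * \<omega>) *v v = (\<i> * \<omega>) *s v"
          by (simp add: vec_eq_iff matrix_vector_mult_def mat_def if_distrib[of "\<lambda>x. x * _"] cong: if_cong)
        then show ?thesis by (simp add: vec_eq_iff complex_eq_iff)
      qed
      also have "(\<chi> j k. complex_mat M $ j $ k * \<i>) *v v = complex_mat M *v (\<i> *s v)"
        by (simp add: vec_eq_iff matrix_vector_mult_def mult.assoc)
      finally show ?thesis .
    qed
    have "v \<bullet> (complex_mat W *v (S \<xi> *v v)) = - Im \<omega> * (v \<bullet> (complex_mat W *v v))"
    proof -
      have "complex_mat W *v (S \<xi> *v v) = - (Im \<omega> *\<^sub>R (complex_mat W *v v)) + Re \<omega> *\<^sub>R (complex_mat W *v (\<i> *s v))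
          + complex_mat (W ** M) *v (\<i> *s v)"
        unfolding Sv
        by (simp add: matrix_vector_right_distrib linear_cmul[OF matrix_vector_mul_linear]
          matrix_vector_mult_diff_distrib complex_mat_mult matrix_vector_mul_assoc matrix_mul_assoc)
      then show ?thesis by (simp add: inner_add_right inner_diff_right zeroM zeroW)
    qed
    moreover have "c * (norm v)\<^sup>2 \<le> v \<bullet> (complex_mat W *v v)" by (rule inner_pos_def_lower[OF c(2)])
    ultimately have "\<bar>Im \<omega>\<bar> * (c * (norm v)\<^sup>2) \<le> \<bar>v \<bullet> (complex_mat W *v (S \<xi> *v v))\<bar>"
      by (simp add: abs_mult mult_left_mono)
    also have "\<dots> \<le> norm v * norm (complex_mat W *v (S \<xi> *v v))"
      by (rule Cauchy_Schwarz_ineq2)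
    also have "\<dots> \<le> norm v * (L * norm (S \<xi> *v v))"
      unfolding L_def by (intro mult_left_mono onorm matrix_vector_mul_bounded_linear) simp
    finally have "norm v * (c * \<bar>Im \<omega>\<bar> * norm v) \<le> norm v * (L * norm (S \<xi> *v v))"
      by (simp add: power2_eq_square mult_ac)
    then have "c * \<bar>Im \<omega>\<bar> * norm v \<le> L * norm (S \<xi> *v v)"
      using False by simp
    then show ?thesis
      using c(1) Im by (simp add: K_def field_simps)
  qed
  then show ?thesis
    by (intro exI[of _ K]) (unfold_locales, simp_all add: S mat_def)
qed

section \<open>Maxwell symbols\<close>

text \<open>The matrix multiplying the \<open>l\<close>-th partial derivative, with \<open>m\<close>
  the inverse permeability and \<open>e\<close> the inverse permittivity; the second branch is
  \<open>l = 2\<close>.\<close>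

definition maxwell2_coeff :: "real \<Rightarrow> real^2^2 \<Rightarrow> 2 \<Rightarrow> real^3^3" where
  "maxwell2_coeff m e l =
     (if l = 1 then vector [vector [0, 0, 0], vector [0, 0, m], vector [e $ 2 $ 1, e $ 2 $ 2, 0]]
      else vector [vector [0, 0, - m], vector [0, 0, 0], vector [- e $ 1 $ 1, - e $ 1 $ 2, 0]])"

definition maxwell2_symmetrizer :: "real \<Rightarrow> real^2^2 \<Rightarrow> real^3^3" where
  "maxwell2_symmetrizer m e =
     vector [vector [e $ 1 $ 1, e $ 1 $ 2, 0], vector [e $ 2 $ 1, e $ 2 $ 2, 0], vector [0, 0, m]]"

lemma pos_def_symmetric: "pos_def A \<Longrightarrow> A $ i $ j = A $ j $ i"
  unfolding pos_def_def by (metis transpose_def vec_lambda_beta)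

lemma maxwell2_symmetrizer_pos_def:
  assumes "pos_def e" "0 < m"
  shows "pos_def (maxwell2_symmetrizer m e)"
  unfolding pos_def_def
proof (intro conjI allI impI)
  have e: "e $ 2 $ 1 = e $ 1 $ 2" by (rule pos_def_symmetric[OF assms(1)])
  show "transpose (maxwell2_symmetrizer m e) = maxwell2_symmetrizer m e"
    by (simp add: vec_eq_iff forall_3 transpose_def maxwell2_symmetrizer_def e)
  fix x :: "real^3" assume x: "x \<noteq> 0"
  define y :: "real^2" where "y = vector [x $ 1, x $ 2]"
  have eq: "x \<bullet> (maxwell2_symmetrizer m e *v x) = y \<bullet> (e *v y) + m * (x $ 3)\<^sup>2"
    by (simp add: inner_vec_def matrix_vector_mult_def maxwell2_symmetrizer_def y_def sum_3 sum_2
        power2_eq_square algebra_simps)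
  have pos: "y \<noteq> 0 \<Longrightarrow> 0 < y \<bullet> (e *v y)" using assms(1) by (simp add: pos_def_def)
  show "0 < x \<bullet> (maxwell2_symmetrizer m e *v x)"
  proof (cases "y = 0")
    case True
    then have "x $ 1 = 0" "x $ 2 = 0" by (simp_all add: y_def vec_eq_iff forall_2)
    with x have "x $ 3 \<noteq> 0" by (auto simp: vec_eq_iff forall_3)
    then show ?thesis using True assms(2) by (simp add: eq)
  next
    case False
    then show ?thesis using pos assms(2) by (simp add: eq add_pos_nonneg)
  qed
qed

text \<open>Multiplication by the symmetrizer puts \<open>e\<close> into the upper right block and
  \<open>m\<close> into the lower left one; the blocks become transposes of each other as
  \<open>e\<close> is symmetric.\<close>

lemma maxwell2_symmetrizer:
  assumes "pos_def e"
  shows "transpose (maxwell2_symmetrizer m e ** maxwell2_coeff m e l) = maxwell2_symmetrizer m e ** maxwell2_coeff m e l"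
proof -
  have e: "e $ 2 $ 1 = e $ 1 $ 2" by (rule pos_def_symmetric[OF assms])
  show ?thesis
    by (simp add: vec_eq_iff forall_3 transpose_def matrix_matrix_mult_def sum_3
        maxwell2_symmetrizer_def maxwell2_coeff_def e mult.commute)
qed

lemma maxwell2_symbol_entry:
  "maxwell2_symbol \<mu> \<epsilon> \<omega> \<xi> $ j $ k = (if j = k then \<i> * \<omega> else 0) +
     (\<Sum>l\<in>UNIV. of_real (\<xi> $ l) * (\<i> * of_real (maxwell2_coeff (inverse \<mu>) (matrix_inv \<epsilon>) l $ j $ k)))"
proof -
  have "\<forall>j k. maxwell2_symbol \<mu> \<epsilon> \<omega> \<xi> $ j $ k = (if j = k then \<i> * \<omega> else 0) +
     (\<Sum>l\<in>UNIV. of_real (\<xi> $ l) * (\<i> * of_real (maxwell2_coeff (inverse \<mu>) (matrix_inv \<epsilon>) l $ j $ k)))"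
    by (simp add: forall_3 sum_2 maxwell2_symbol_def maxwell2_coeff_def complex_mat_def Let_def algebra_simps)
  then show ?thesis by blast
qed

lemma maxwell2_component:
  "maxwell2 \<mu> \<epsilon> \<omega> T \<phi> $ j = (\<Sum>k\<in>UNIV. mat (\<i> * \<omega>) $ j $ k * T \<phi> $ k +
     (\<Sum>l\<in>UNIV. - \<i> * (\<chi> j k. \<i> * of_real (maxwell2_coeff (inverse \<mu>) (matrix_inv \<epsilon>) l $ j $ k)) $ j $ k *
        dpartial l T \<phi> $ k))"
proof -
  have "\<forall>j. maxwell2 \<mu> \<epsilon> \<omega> T \<phi> $ j = (\<Sum>k\<in>UNIV. mat (\<i> * \<omega>) $ j $ k * T \<phi> $ k +
     (\<Sum>l\<in>UNIV. - \<i> * (\<chi> j k. \<i> * of_real (maxwell2_coeff (inverse \<mu>) (matrix_inv \<epsilon>) l $ j $ k)) $ j $ k *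
        dpartial l T \<phi> $ k))"
    by (simp add: forall_3 sum_3 sum_2 maxwell2_def maxwell2_coeff_def complex_mat_def mat_def Let_def algebra_simps)
  then show ?thesis by blast
qed

text \<open>The first two components are \<open>\<i> * \<omega> * u\<close> plus a rotated gradient
  of the third. Divergence kills the former by assumption on \<open>u\<close> and the latter because
  mixed derivatives commute.\<close>

lemma maxwell2_range_divergence_free:
  assumes u: "u \<in> Lp0_2 q" and f: "f \<in> Lp p"
    and eq: "\<And>\<phi>. schwartz \<phi> \<Longrightarrow> regular f \<phi> = maxwell2 \<mu> \<epsilon> \<omega> (regular u) \<phi>"
  shows "f \<in> Lp0_2 p"
proof -
  have "dpartial 1 (regular f) \<phi> $ 1 + dpartial 2 (regular f) \<phi> $ 2 = 0" if \<phi>: "schwartz \<phi>" for \<phi>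
  proof -
    have div: "regular u (pd 1 \<phi>) $ 1 = - (regular u (pd 2 \<phi>) $ 2)"
      using u \<phi> unfolding Lp0_2_def by (auto simp: dpartial_def eq_neg_iff_add_eq_0 add_eq_0_iff)
    have c: "pd 2 (pd 1 \<phi>) = pd 1 (pd 2 \<phi>)" by (rule schwartz_pd_commute[OF \<phi>])
    show ?thesis
      by (simp add: dpartial_def eq schwartz_pd \<phi> maxwell2_def Let_def c div)
  qed
  then show ?thesis using f by (simp add: Lp0_2_def)
qed

text \<open>\<open>levi_civita l\<close> is the matrix of the cross product with the
  \<open>l\<close>-th unit vector, so the curl is the sum over \<open>l\<close> of this matrix times
  the \<open>l\<close>-th derivative.\<close>

definition levi_civita :: "3 \<Rightarrow> real^3^3" where
  "levi_civita l =
     (if l = 1 then vector [vector [0, 0, 0], vector [0, 0, - 1], vector [0, 1, 0]]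
      else if l = 2 then vector [vector [0, 0, 1], vector [0, 0, 0], vector [- 1, 0, 0]]
      else vector [vector [0, - 1, 0], vector [1, 0, 0], vector [0, 0, 0]])"

lemma curl_symbol_entry: "curl_symbol \<xi> $ i $ j = (\<Sum>l\<in>UNIV. of_real (\<xi> $ l) * (\<i> * of_real (levi_civita l $ i $ j)))"
proof -
  have "\<forall>i j. curl_symbol \<xi> $ i $ j = (\<Sum>l\<in>UNIV. of_real (\<xi> $ l) * (\<i> * of_real (levi_civita l $ i $ j)))"
    by (simp add: forall_3 sum_3 curl_symbol_def levi_civita_def Let_def mult.commute)
  then show ?thesis by blast
qed

lemma dcurl_component: "dcurl T \<phi> $ i = (\<Sum>j\<in>UNIV. \<Sum>l\<in>UNIV. of_real (levi_civita l $ i $ j) * dpartial l T \<phi> $ j)"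
proof -
  have "\<forall>i. dcurl T \<phi> $ i = (\<Sum>j\<in>UNIV. \<Sum>l\<in>UNIV. of_real (levi_civita l $ i $ j) * dpartial l T \<phi> $ j)"
    by (simp add: forall_3 sum_3 dcurl_def levi_civita_def Let_def)
  then show ?thesis by blast
qed

text \<open>This sign compensates the one between the two curls in Maxwell's equations.\<close>

lemma levi_civita_antisymmetric: "levi_civita l $ j $ i = - levi_civita l $ i $ j"
proof -
  have "\<forall>i j. levi_civita l $ j $ i = - levi_civita l $ i $ j"
    by (simp add: forall_3 levi_civita_def)
  then show ?thesis by blast
qed

definition maxwell3_coeff :: "real \<Rightarrow> real^3^3 \<Rightarrow> 3 \<Rightarrow> real^(3 + 3)^(3 + 3)" where
  "maxwell3_coeff m e l = (\<chi> j k. case (j, k) of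
       (Inl i, Inr k) \<Rightarrow> - m * levi_civita l $ i $ k
     | (Inr i, Inl k) \<Rightarrow> (levi_civita l ** e) $ i $ k
     | _ \<Rightarrow> 0)"

definition maxwell3_symmetrizer :: "real \<Rightarrow> real^3^3 \<Rightarrow> real^(3 + 3)^(3 + 3)" where
  "maxwell3_symmetrizer m e = (\<chi> j k. case (j, k) of
       (Inl i, Inl k) \<Rightarrow> e $ i $ k
     | (Inr i, Inr k) \<Rightarrow> if i = k then m else 0
     | _ \<Rightarrow> 0)"

lemma sum_UNIV_Plus: "(\<Sum>k\<in>UNIV. f k) = (\<Sum>i\<in>UNIV. f (Inl i)) + (\<Sum>i\<in>UNIV. f (Inr i))"
  for f :: "'a::finite + 'b::finite \<Rightarrow> 'c::comm_monoid_add"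
  unfolding UNIV_Plus_UNIV[symmetric] by (subst sum.Plus) (simp_all add: o_def)

lemma sum_mat_mult: "(\<Sum>k\<in>UNIV. mat c $ j $ k * v k) = c * v j" for c :: complex
  by (subst sum.remove[of _ j]) (auto simp: mat_def intro!: sum.neutral)

lemma forall_Plus: "(\<forall>k. P k) \<longleftrightarrow> (\<forall>i. P (Inl i)) \<and> (\<forall>i. P (Inr i))"
  by (metis sum.exhaust)

lemma maxwell3_symmetrizer_pos_def:
  assumes "pos_def e" "0 < m"
  shows "pos_def (maxwell3_symmetrizer m e)"
  unfolding pos_def_def
proof (intro conjI allI impI)
  show "transpose (maxwell3_symmetrizer m e) = maxwell3_symmetrizer m e"
    by (simp add: vec_eq_iff forall_Plus transpose_def maxwell3_symmetrizer_def pos_def_symmetric[OF assms(1)])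
  fix x :: "real^(3 + 3)" assume x: "x \<noteq> 0"
  define y :: "real^3" where "y = (\<chi> i. x $ Inl i)"
  define z :: "real^3" where "z = (\<chi> i. x $ Inr i)"
  have eq: "x \<bullet> (maxwell3_symmetrizer m e *v x) = y \<bullet> (e *v y) + m * (z \<bullet> z)"
    by (simp add: inner_vec_def matrix_vector_mult_def maxwell3_symmetrizer_def y_def z_def sum_UNIV_Plus
        sum_distrib_left mult.left_commute if_distrib[of "\<lambda>x. x * _"] cong: if_cong)
  have pos: "y \<noteq> 0 \<Longrightarrow> 0 < y \<bullet> (e *v y)" using assms(1) by (simp add: pos_def_def)
  show "0 < x \<bullet> (maxwell3_symmetrizer m e *v x)"
  proof (cases "y = 0")
    case True
    with x have "z \<noteq> 0" by (auto simp: y_def z_def vec_eq_iff forall_Plus)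
    then show ?thesis using True assms(2) by (simp add: eq)
  next
    case False
    then show ?thesis using pos assms(2) by (simp add: eq add_pos_nonneg)
  qed
qed

text \<open>With \<open>L = levi_civita l\<close>, the off-diagonal blocks of the product are
  \<open>- m e L\<close> and \<open>m L e\<close>. They are transposes of each other because
  \<open>e\<close> is symmetric and \<open>L\<close> is skew.\<close>

lemma maxwell3_symmetrizer:
  assumes "pos_def e"
  shows "transpose (maxwell3_symmetrizer m e ** maxwell3_coeff m e l) = maxwell3_symmetrizer m e ** maxwell3_coeff m e l"
proof -
  have "m * (\<Sum>k\<in>UNIV. levi_civita l $ j $ k * e $ k $ i) = - (\<Sum>k\<in>UNIV. e $ i $ k * (m * levi_civita l $ k $ j))" for i j
    unfolding sum_distrib_left sum_negf[symmetric]
  proof (rule sum.cong[OF refl])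
    fix k
    show "m * (levi_civita l $ j $ k * e $ k $ i) = - (e $ i $ k * (m * levi_civita l $ k $ j))"
      by (simp add: levi_civita_antisymmetric[of l j k] pos_def_symmetric[OF assms, of k i])
  qed
  then show ?thesis
    by (simp add: vec_eq_iff forall_Plus transpose_def matrix_matrix_mult_def sum_UNIV_Plus
        maxwell3_symmetrizer_def maxwell3_coeff_def sum_negf if_distrib[of "\<lambda>x. x * _"] cong: if_cong)
qed

lemma maxwell3_symbol_entry:
  "maxwell3_symbol \<mu> \<epsilon> \<omega> \<xi> $ j $ k = (if j = k then \<i> * \<omega> else 0) +
     (\<Sum>l\<in>UNIV. of_real (\<xi> $ l) * (\<i> * of_real (maxwell3_coeff (inverse \<mu>) (matrix_inv \<epsilon>) l $ j $ k)))"
proof -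
  have "(curl_symbol \<xi> ** complex_mat e) $ i $ k =
      (\<Sum>l\<in>UNIV. of_real (\<xi> $ l) * (\<i> * of_real ((levi_civita l ** e) $ i $ k)))" for e i k
    by (simp add: matrix_matrix_mult_def complex_mat_def curl_symbol_entry sum_distrib_left sum_distrib_right mult.assoc)
      (rule sum.swap)
  then show ?thesis
    by (cases j; cases k)
      (simp_all add: maxwell3_symbol_def maxwell3_coeff_def curl_symbol_entry sum_distrib_left mult_ac sum_negf)
qed

lemma maxwell3_component:
  "maxwell3 \<mu> \<epsilon> \<omega> T \<phi> $ j = (\<Sum>k\<in>UNIV. mat (\<i> * \<omega>) $ j $ k * T \<phi> $ k +
     (\<Sum>l\<in>UNIV. - \<i> * (\<chi> j k. \<i> * of_real (maxwell3_coeff (inverse \<mu>) (matrix_inv \<epsilon>) l $ j $ k)) $ j $ k *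
        dpartial l T \<phi> $ k))"
proof (cases j)
  case (Inl i)
  then show ?thesis
    unfolding sum.distrib sum_mat_mult
    by (simp add: sum_UNIV_Plus maxwell3_def maxwell3_coeff_def dcurl_component dpartial_def
        sum_distrib_left mult_ac sum_negf)
next
  case (Inr i)
  let ?e = "matrix_inv \<epsilon>"
  have "dcurl (\<lambda>\<psi>. complex_mat ?e *v (\<chi> i. T \<psi> $ Inl i)) \<phi> $ i =
    (\<Sum>j\<in>UNIV. \<Sum>l\<in>UNIV. \<Sum>k\<in>UNIV. of_real (levi_civita l $ i $ j) * of_real (?e $ j $ k) * dpartial l T \<phi> $ Inl k)"
    by (simp add: dcurl_component dpartial_def matrix_vector_mult_def complex_mat_def sum_distrib_left sum_negf mult.assoc)
  \<comment> \<open>The intermediate index \<open>j\<close> has to be innermost in order to form the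
    product \<open>levi_civita l ** ?e\<close>.\<close>
  also have "\<dots> = (\<Sum>l\<in>UNIV. \<Sum>k\<in>UNIV. \<Sum>j\<in>UNIV. of_real (levi_civita l $ i $ j) * of_real (?e $ j $ k) * dpartial l T \<phi> $ Inl k)"
    by (subst sum.swap) (rule sum.cong[OF refl], rule sum.swap)
  also have "\<dots> = (\<Sum>l\<in>UNIV. \<Sum>k\<in>UNIV. of_real ((levi_civita l ** ?e) $ i $ k) * dpartial l T \<phi> $ Inl k)"
    by (simp add: matrix_matrix_mult_def sum_distrib_right)
  also have "\<dots> = (\<Sum>k\<in>UNIV. \<Sum>l\<in>UNIV. of_real ((levi_civita l ** ?e) $ i $ k) * dpartial l T \<phi> $ Inl k)"
    by (rule sum.swap)
  finally have c: "dcurl (\<lambda>\<psi>. complex_mat ?e *v (\<chi> i. T \<psi> $ Inl i)) \<phi> $ i = \<dots>" .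
  show ?thesis
    using Inr unfolding sum.distrib sum_mat_mult
    by (simp add: sum_UNIV_Plus maxwell3_def maxwell3_coeff_def c)
qed

text \<open>Each of the two fields of \<open>P u\<close> is \<open>\<i> * \<omega>\<close> times a
  divergence-free field plus a multiple of a curl.\<close>

lemma maxwell3_range_divergence_free:
  assumes u: "u \<in> Lp0_3 q" and f: "f \<in> Lp p"
    and eq: "\<And>\<phi>. schwartz \<phi> \<Longrightarrow> regular f \<phi> = maxwell3 \<mu> \<epsilon> \<omega> (regular u) \<phi>"
  shows "f \<in> Lp0_3 p"
proof -
  have "(\<Sum>i\<in>UNIV. dpartial i (regular f) \<phi> $ Inl i) = 0 \<and> (\<Sum>i\<in>UNIV. dpartial i (regular f) \<phi> $ Inr i) = 0"
    if \<phi>: "schwartz \<phi>" for \<phi>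
  proof -
    have c: "pd 2 (pd 1 \<phi>) = pd 1 (pd 2 \<phi>)" "pd 3 (pd 1 \<phi>) = pd 1 (pd 3 \<phi>)" "pd 3 (pd 2 \<phi>) = pd 2 (pd 3 \<phi>)"
      by (rule schwartz_pd_commute[OF \<phi>])+
    \<comment> \<open>Stated for arbitrary \<open>T\<close>, as it is applied both to the second
      field and to the inverse permittivity times the first one.\<close>
    have divcurl: "(\<Sum>i\<in>UNIV. dcurl T (pd i \<phi>) $ i) = 0" for T
      by (simp add: sum_3 dcurl_def dpartial_def Let_def c)
    have div: "(\<Sum>i\<in>UNIV. regular u (pd i \<phi>) $ Inl i) = 0" "(\<Sum>i\<in>UNIV. regular u (pd i \<phi>) $ Inr i) = 0"
      using u \<phi> unfolding Lp0_3_def by (auto simp: dpartial_def sum_negf)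
    show ?thesis
      by (simp add: dpartial_def eq schwartz_pd \<phi> maxwell3_def Let_def sum_negf sum_subtractf sum.distrib
          sum_distrib_left[symmetric] div divcurl)
  qed
  then show ?thesis using f by (simp add: Lp0_3_def)
qed

section \<open>Absence of eigenvalues for small potentials\<close>

lemma maxwell2_no_eigenvalue:
  assumes "0 < \<mu>" "1 < p" "p \<le> q" "0 < B" "0 < t" "t < 1" "pos_def \<epsilon>"
    and "multiplier_norm (ennreal p) (Lp0_2 (ennreal p)) (ennreal q) (Lp0_2 (ennreal q))
      (\<lambda>\<xi>. matrix_inv (maxwell2_symbol \<mu> \<epsilon> E \<xi>)) \<le> ennreal B"
    and "V \<in> borel_measurable lebesgue" "potential_norm (potential_exponent p q) V \<le> ennreal (t * inverse B)"
  shows "\<not> is_eigenvalue (maxwell2 \<mu> \<epsilon>) (Lp0_2 (ennreal q)) V E"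
proof
  assume "is_eigenvalue (maxwell2 \<mu> \<epsilon>) (Lp0_2 (ennreal q)) V E"
  then obtain u where E: "E \<notin> \<real>" and u: "u \<in> Lp0_2 (ennreal q)" "\<not> (AE x in lebesgue. u x = 0)"
    and eq: "dist_eq (\<lambda>\<phi>. maxwell2 \<mu> \<epsilon> E (regular u) \<phi> + regular (\<lambda>x. V x *v u x) \<phi>) (\<lambda>_. 0)"
    unfolding is_eigenvalue_def by blast
  let ?m = "inverse \<mu>" and ?e = "matrix_inv \<epsilon>"
  have e: "pos_def ?e" by (rule pos_def_matrix_inv) fact
  obtain K where "affine_symbol (maxwell2_symbol \<mu> \<epsilon> E) (mat (\<i> * E))
      (\<lambda>l. \<chi> j k. \<i> * of_real (maxwell2_coeff ?m ?e l $ j $ k)) K"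
    using symmetrizable_affine_symbol[OF maxwell2_symmetrizer_pos_def[OF e] maxwell2_symmetrizer[OF e] E
        maxwell2_symbol_entry] assms(1) by auto
  then interpret affine_symbol "maxwell2_symbol \<mu> \<epsilon> E" "mat (\<i> * E)"
    "\<lambda>l. \<chi> j k. \<i> * of_real (maxwell2_coeff ?m ?e l $ j $ k)" K .
  \<comment> \<open>The premises left open are the inclusion of the divergence-free space in the
    Lebesgue space and the divergence condition for \<open>- V u\<close>.\<close>
  have "AE x in lebesgue. u x = 0"
    by (rule eigenfunction_zero[OF maxwell2_component assms(2-6,8-10) _ u(1) _ eq])
      (auto simp: Lp0_2_def[of "ennreal q"] intro: maxwell2_range_divergence_free[OF u(1)])
  with u(2) show False by simp
qed

lemma maxwell3_no_eigenvalue: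
  assumes "0 < \<mu>" "1 < p" "p \<le> q" "0 < B" "0 < t" "t < 1" "pos_def \<epsilon>"
    and "multiplier_norm (ennreal p) (Lp0_3 (ennreal p)) (ennreal q) (Lp0_3 (ennreal q))
      (\<lambda>\<xi>. matrix_inv (maxwell3_symbol \<mu> \<epsilon> E \<xi>)) \<le> ennreal B"
    and "V \<in> borel_measurable lebesgue" "potential_norm (potential_exponent p q) V \<le> ennreal (t * inverse B)"
  shows "\<not> is_eigenvalue (maxwell3 \<mu> \<epsilon>) (Lp0_3 (ennreal q)) V E"
proof
  assume "is_eigenvalue (maxwell3 \<mu> \<epsilon>) (Lp0_3 (ennreal q)) V E"
  then obtain u where E: "E \<notin> \<real>" and u: "u \<in> Lp0_3 (ennreal q)" "\<not> (AE x in lebesgue. u x = 0)"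
    and eq: "dist_eq (\<lambda>\<phi>. maxwell3 \<mu> \<epsilon> E (regular u) \<phi> + regular (\<lambda>x. V x *v u x) \<phi>) (\<lambda>_. 0)"
    unfolding is_eigenvalue_def by blast
  let ?m = "inverse \<mu>" and ?e = "matrix_inv \<epsilon>"
  have e: "pos_def ?e" by (rule pos_def_matrix_inv) fact
  obtain K where "affine_symbol (maxwell3_symbol \<mu> \<epsilon> E) (mat (\<i> * E))
      (\<lambda>l. \<chi> j k. \<i> * of_real (maxwell3_coeff ?m ?e l $ j $ k)) K"
    using symmetrizable_affine_symbol[OF maxwell3_symmetrizer_pos_def[OF e] maxwell3_symmetrizer[OF e] E
        maxwell3_symbol_entry] assms(1) by auto
  then interpret affine_symbol "maxwell3_symbol \<mu> \<epsilon> E" "mat (\<i> * E)"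
    "\<lambda>l. \<chi> j k. \<i> * of_real (maxwell3_coeff ?m ?e l $ j $ k)" K .
  have "AE x in lebesgue. u x = 0"
    by (rule eigenfunction_zero[OF maxwell3_component assms(2-6,8-10) _ u(1) _ eq])
      (auto simp: Lp0_3_def[of "ennreal q"] intro: maxwell3_range_divergence_free[OF u(1)])
  with u(2) show False by simp
qed

text \<open>The condition \<open>0 <= x - y\<close> of the region at inverse exponents; it is what
  makes Hoelder's inequality applicable to \<open>V u\<close>.\<close>

lemma R_half_exponents:
  assumes "1 < p" "1 < q" "(1 / p, 1 / q) \<in> R_half d"
  shows "p \<le> q"
  using assms by (auto simp: R_half_def field_simps)

theorem corollary4p1:
  fixes \<mu> l p q C t :: real and E :: complex
  assumes "0 < \<mu>" and "0 < l" and "1 < p" and "1 < q" and "0 < C" and "0 < t" and "t < 1"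
  shows
    "(\<forall>(\<epsilon> :: real^2^2) (V :: real^2 \<Rightarrow> complex^3^3).
        pos_def \<epsilon> \<longrightarrow>
        (1 / p, 1 / q) \<in> R_half 2 \<longrightarrow>
        (\<forall>\<omega>. \<omega> \<notin> \<real> \<longrightarrow>
           multiplier_norm (ennreal p) (Lp0_2 (ennreal p)) (ennreal q) (Lp0_2 (ennreal q))
             (\<lambda>\<xi>. matrix_inv (maxwell2_symbol \<mu> \<epsilon> \<omega> \<xi>))
           \<le> ennreal (C * kappa 2 (1 / p) (1 / q) \<omega>)) \<longrightarrow>
        V \<in> borel_measurable lebesgue \<longrightarrow>
        potential_norm (potential_exponent p q) V \<le> ennreal (t * inverse (C * l)) \<longrightarrow>
        is_eigenvalue (maxwell2 \<mu> \<epsilon>) (Lp0_2 (ennreal q)) V E \<longrightarrow>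
        E \<in> - Zset 2 (1 / p) (1 / q) l)
     \<and>
     (\<forall>(\<epsilon> :: real^3^3) (V :: real^3 \<Rightarrow> complex^(3 + 3)^(3 + 3)).
        pos_def \<epsilon> \<longrightarrow>
        (\<forall>i j. i \<noteq> j \<longrightarrow> \<epsilon> $ i $ j = 0) \<longrightarrow>
        card {\<epsilon> $ 1 $ 1, \<epsilon> $ 2 $ 2, \<epsilon> $ 3 $ 3} \<le> 2 \<longrightarrow>
        (1 / p, 1 / q) \<in> R_half_tilde3 \<longrightarrow>
        (\<forall>\<omega>. \<omega> \<notin> \<real> \<longrightarrow>
           multiplier_norm (ennreal p) (Lp0_3 (ennreal p)) (ennreal q) (Lp0_3 (ennreal q))
             (\<lambda>\<xi>. matrix_inv (maxwell3_symbol \<mu> \<epsilon> \<omega> \<xi>))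
           \<le> ennreal (C * kappa 3 (1 / p) (1 / q) \<omega>)) \<longrightarrow>
        V \<in> borel_measurable lebesgue \<longrightarrow>
        potential_norm (potential_exponent p q) V \<le> ennreal (t * inverse (C * l)) \<longrightarrow>
        is_eigenvalue (maxwell3 \<mu> \<epsilon>) (Lp0_3 (ennreal q)) V E \<longrightarrow>
        E \<in> - Zset 3 (1 / p) (1 / q) l)"
proof (intro conjI allI impI)
  fix \<epsilon> :: "real^2^2" and V :: "real^2 \<Rightarrow> complex^3^3"
  assume \<epsilon>: "pos_def \<epsilon>" and R: "(1 / p, 1 / q) \<in> R_half 2"
    and M: "\<forall>\<omega>. \<omega> \<notin> \<real> \<longrightarrow>
           multiplier_norm (ennreal p) (Lp0_2 (ennreal p)) (ennreal q) (Lp0_2 (ennreal q))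
             (\<lambda>\<xi>. matrix_inv (maxwell2_symbol \<mu> \<epsilon> \<omega> \<xi>))
           \<le> ennreal (C * kappa 2 (1 / p) (1 / q) \<omega>)"
    and V: "V \<in> borel_measurable lebesgue" "potential_norm (potential_exponent p q) V \<le> ennreal (t * inverse (C * l))"
    and E: "is_eigenvalue (maxwell2 \<mu> \<epsilon>) (Lp0_2 (ennreal q)) V E"
  show "E \<in> - Zset 2 (1 / p) (1 / q) l"
  proof
    \<comment> \<open>On the sublevel set of \<open>kappa\<close> the resolvent bound at
      \<open>E\<close> becomes \<open>C * l\<close>, the same constant as in the smallness
      assumption on \<open>V\<close>.\<close>
    assume "E \<in> Zset 2 (1 / p) (1 / q) l"
    then have "E \<notin> \<real>" "C * kappa 2 (1 / p) (1 / q) E \<le> C * l"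
      using \<open>0 < C\<close> by (simp_all add: Zset_def)
    then have "multiplier_norm (ennreal p) (Lp0_2 (ennreal p)) (ennreal q) (Lp0_2 (ennreal q))
        (\<lambda>\<xi>. matrix_inv (maxwell2_symbol \<mu> \<epsilon> E \<xi>)) \<le> ennreal (C * l)"
      using M by (meson ennreal_leI order_trans)
    from maxwell2_no_eigenvalue[OF \<open>0 < \<mu>\<close> \<open>1 < p\<close> R_half_exponents[OF \<open>1 < p\<close> \<open>1 < q\<close> R]
        mult_pos_pos[OF \<open>0 < C\<close> \<open>0 < l\<close>] \<open>0 < t\<close> \<open>t < 1\<close> \<epsilon> this V] E
    show False by contradiction
  qed
next
  fix \<epsilon> :: "real^3^3" and V :: "real^3 \<Rightarrow> complex^(3 + 3)^(3 + 3)"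
  assume \<epsilon>: "pos_def \<epsilon>" and R: "(1 / p, 1 / q) \<in> R_half_tilde3"
    and M: "\<forall>\<omega>. \<omega> \<notin> \<real> \<longrightarrow>
           multiplier_norm (ennreal p) (Lp0_3 (ennreal p)) (ennreal q) (Lp0_3 (ennreal q))
             (\<lambda>\<xi>. matrix_inv (maxwell3_symbol \<mu> \<epsilon> \<omega> \<xi>))
           \<le> ennreal (C * kappa 3 (1 / p) (1 / q) \<omega>)"
    and V: "V \<in> borel_measurable lebesgue" "potential_norm (potential_exponent p q) V \<le> ennreal (t * inverse (C * l))"
    and E: "is_eigenvalue (maxwell3 \<mu> \<epsilon>) (Lp0_3 (ennreal q)) V E"
  have R': "(1 / p, 1 / q) \<in> R_half 3" using R by (simp add: R_half_tilde3_def)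
  show "E \<in> - Zset 3 (1 / p) (1 / q) l"
  proof
    assume "E \<in> Zset 3 (1 / p) (1 / q) l"
    then have "E \<notin> \<real>" "C * kappa 3 (1 / p) (1 / q) E \<le> C * l"
      using \<open>0 < C\<close> by (simp_all add: Zset_def)
    then have "multiplier_norm (ennreal p) (Lp0_3 (ennreal p)) (ennreal q) (Lp0_3 (ennreal q))
        (\<lambda>\<xi>. matrix_inv (maxwell3_symbol \<mu> \<epsilon> E \<xi>)) \<le> ennreal (C * l)"
      using M by (meson ennreal_leI order_trans)
    from maxwell3_no_eigenvalue[OF \<open>0 < \<mu>\<close> \<open>1 < p\<close> R_half_exponents[OF \<open>1 < p\<close> \<open>1 < q\<close> R']
        mult_pos_pos[OF \<open>0 < C\<close> \<open>0 < l\<close>] \<open>0 < t\<close> \<open>t < 1\<close> \<epsilon> this V] E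
    show False by contradiction
  qed
qed

end
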